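(* Let $J\colon L^2(0,1)\to L^2(0,1)$, $[Jx](s)=\int_0^sx(t)\,dt$ $(0\le s\le1)$, be the integration operator and let $B^{(H)}\colon L^2(0,1)\to\ell^2$, $[B^{(H)}z]_j=\int_0^1t^{j-1}z(t)\,dt$ $(j=1,2,\dots)$, be the Hausdorff moment operator. Then there exist positive constants $\underline{C}$ and $\overline{C}$ such that $$\exp(-\underline{C}\,i)\le\sigma_i\left(B^{(H)}\circ J\right)\le\frac{\overline{C}}{i}$$ is valid for all sufficiently large indices $i\in\mathbb{N}$.
   Context: All function spaces are real. For a compact linear operator $T$ between Hilbert spaces, $\sigma_1(T)\ge\sigma_2(T)\ge\dots$ denote its singular values, listed in non-increasing order with multiplicity. *)

theory Defs
  imports "HOL-Analysis.Analysis"
begin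

section \<open>The real Hilbert space \<open>L\<^sup>2(0,1)\<close>\<close>

abbreviation unit_measure :: "real measure" where
  "unit_measure \<equiv> lebesgue_on {0<..<1}"

definition square_integrable :: "(real \<Rightarrow> real) \<Rightarrow> bool" where
  "square_integrable f \<longleftrightarrow>
     f \<in> borel_measurable unit_measure \<and> integrable unit_measure (\<lambda>t. (f t)\<^sup>2)"

definition L2_rel :: "(real \<Rightarrow> real) \<Rightarrow> (real \<Rightarrow> real) \<Rightarrow> bool" where
  "L2_rel f g \<longleftrightarrow> square_integrable f \<and> square_integrable g \<and> (AE t in unit_measure. f t = g t)"

interpretation unit_measure: finite_measure unit_measure
  by (rule finite_measure_lebesgue_on) simp

lemma square_integrable_zero: "square_integrable (\<lambda>_. 0)"
  by (simp add: square_integrable_def)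

lemma integrable_mult_square_integrable:
  assumes "square_integrable f" "square_integrable g"
  shows "integrable unit_measure (\<lambda>t. f t * g t)"
proof (rule Bochner_Integration.integrable_bound)
  show "integrable unit_measure (\<lambda>t. (f t)\<^sup>2 + (g t)\<^sup>2)"
    using assms by (simp add: square_integrable_def)
  show "(\<lambda>t. f t * g t) \<in> borel_measurable unit_measure"
    using assms unfolding square_integrable_def by (intro borel_measurable_times) auto
  have "\<bar>a * b\<bar> \<le> a\<^sup>2 + b\<^sup>2" for a b :: real
  proof -
    have "2 * (\<bar>a\<bar> * \<bar>b\<bar>) \<le> a\<^sup>2 + b\<^sup>2"
      using sum_squares_bound [of "\<bar>a\<bar>" "\<bar>b\<bar>"] by simp
    moreover have "0 \<le> \<bar>a\<bar> * \<bar>b\<bar>" by simp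
    ultimately show ?thesis unfolding abs_mult by linarith
  qed
  then show "AE t in unit_measure. norm (f t * g t) \<le> norm ((f t)\<^sup>2 + (g t)\<^sup>2)"
    by simp
qed

lemma square_integrable_add:
  assumes "square_integrable f" "square_integrable g"
  shows "square_integrable (\<lambda>t. f t + g t)"
proof -
  have "integrable unit_measure (\<lambda>t. (f t)\<^sup>2 + (g t)\<^sup>2 + 2 * (f t * g t))"
    using assms integrable_mult_square_integrable [OF assms] by (simp add: square_integrable_def)
  also have "(\<lambda>t. (f t)\<^sup>2 + (g t)\<^sup>2 + 2 * (f t * g t)) = (\<lambda>t. (f t + g t)\<^sup>2)"
    by (simp add: power2_sum algebra_simps)
  finally show ?thesis
    using assms unfolding square_integrable_def by (auto intro: borel_measurable_add)
qed

lemma square_integrable_scale: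
  assumes "square_integrable f"
  shows "square_integrable (\<lambda>t. c * f t)"
  using assms by (auto simp: square_integrable_def power_mult_distrib)

lemma square_integrable_bounded:
  assumes "f \<in> borel_measurable unit_measure" "\<And>t. \<bar>f t\<bar> \<le> K"
  shows "square_integrable f"
  unfolding square_integrable_def
proof
  show "integrable unit_measure (\<lambda>t. (f t)\<^sup>2)"
  proof (rule unit_measure.integrable_const_bound)
    have "\<bar>f t\<bar>\<^sup>2 \<le> K\<^sup>2" for t
      using assms(2) by (intro power_mono) auto
    then show "AE t in unit_measure. norm ((f t)\<^sup>2) \<le> K\<^sup>2" by simp
  qed (use assms(1) in measurable)
qed (fact assms(1))

lemma integrable_square_integrable:
  assumes "square_integrable f"
  shows "integrable unit_measure f"
  using integrable_mult_square_integrable [OF assms square_integrable_bounded [of "\<lambda>_. 1" 1]]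
  by simp

quotient_type L2 = "real \<Rightarrow> real" / partial: L2_rel
proof (rule part_equivpI)
  show "\<exists>f. L2_rel f f"
    using square_integrable_zero by (auto simp: L2_rel_def)
  show "symp L2_rel"
    by (auto intro!: sympI simp: L2_rel_def)
  show "transp L2_rel"
  proof (rule transpI)
    fix f g h assume "L2_rel f g" "L2_rel g h"
    then show "L2_rel f h"
      unfolding L2_rel_def by (auto elim: AE_mp)
  qed
qed

instantiation L2 :: real_inner
begin

lift_definition zero_L2 :: L2 is "\<lambda>_. 0"
  by (simp add: L2_rel_def square_integrable_zero)

lift_definition plus_L2 :: "L2 \<Rightarrow> L2 \<Rightarrow> L2" is "\<lambda>f g t. f t + g t"
  by (auto simp: L2_rel_def square_integrable_add)

lift_definition uminus_L2 :: "L2 \<Rightarrow> L2" is "\<lambda>f t. - f t"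
  using square_integrable_scale [where c = "-1"] by (auto simp: L2_rel_def)

definition minus_L2 :: "L2 \<Rightarrow> L2 \<Rightarrow> L2" where "minus_L2 x y = x + - y"

lift_definition scaleR_L2 :: "real \<Rightarrow> L2 \<Rightarrow> L2" is "\<lambda>c f t. c * f t"
  by (auto simp: L2_rel_def square_integrable_scale)

lift_definition inner_L2 :: "L2 \<Rightarrow> L2 \<Rightarrow> real" is "\<lambda>f g. LINT t|unit_measure. f t * g t"
proof -
  fix f f' g g' assume "L2_rel f f'" "L2_rel g g'"
  then show "(LINT t|unit_measure. f t * g t) = (LINT t|unit_measure. f' t * g' t)"
    unfolding L2_rel_def square_integrable_def
    by (intro integral_cong_AE borel_measurable_times) auto
qed

definition norm_L2 :: "L2 \<Rightarrow> real" where "norm_L2 x = sqrt (inner x x)"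
definition sgn_L2 :: "L2 \<Rightarrow> L2" where "sgn_L2 x = inverse (norm x) *\<^sub>R x"
definition dist_L2 :: "L2 \<Rightarrow> L2 \<Rightarrow> real" where "dist_L2 x y = norm (x - y)"
definition uniformity_L2 :: "(L2 \<times> L2) filter" where
  "uniformity_L2 = (INF e\<in>{0<..}. principal {(x, y). dist x y < e})"
definition open_L2 :: "L2 set \<Rightarrow> bool" where
  "open_L2 U \<longleftrightarrow> (\<forall>x\<in>U. \<forall>\<^sub>F (x', y) in uniformity. x' = x \<longrightarrow> y \<in> U)"

instance
proof
  fix x y z :: L2 and a b :: real
  show "x + y + z = x + (y + z)"
    by transfer (auto simp: L2_rel_def algebra_simps intro!: square_integrable_add)
  show "x + y = y + x"
    by transfer (auto simp: L2_rel_def algebra_simps intro!: square_integrable_add)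
  show "0 + x = x"
    by transfer (auto simp: L2_rel_def)
  show "- x + x = 0"
    by transfer (auto simp: L2_rel_def square_integrable_zero)
  show "x - y = x + - y"
    by (simp add: minus_L2_def)
  show "a *\<^sub>R (x + y) = a *\<^sub>R x + a *\<^sub>R y"
    by transfer (auto simp: L2_rel_def algebra_simps
        intro!: square_integrable_add square_integrable_scale)
  show "(a + b) *\<^sub>R x = a *\<^sub>R x + b *\<^sub>R x"
    by transfer (auto simp: L2_rel_def algebra_simps
        intro!: square_integrable_add square_integrable_scale)
  show "a *\<^sub>R b *\<^sub>R x = (a * b) *\<^sub>R x"
    by transfer (auto simp: L2_rel_def mult.assoc intro!: square_integrable_scale)
  show "1 *\<^sub>R x = x"
    by transfer (auto simp: L2_rel_def)
  show "x \<bullet> y = y \<bullet> x"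
    by transfer (simp add: mult.commute)
  show "(x + y) \<bullet> z = x \<bullet> z + y \<bullet> z"
    by transfer (simp add: L2_rel_def distrib_right integrable_mult_square_integrable)
  show "(a *\<^sub>R x) \<bullet> y = a * (x \<bullet> y)"
    by transfer (simp add: mult.assoc)
  show "0 \<le> x \<bullet> x"
    by transfer simp
  show "x \<bullet> x = 0 \<longleftrightarrow> x = 0"
  proof transfer
    fix f assume "L2_rel f f"
    then have f: "square_integrable f" by (simp add: L2_rel_def)
    then have "integral\<^sup>L unit_measure (\<lambda>t. f t * f t) = 0 \<longleftrightarrow> (AE t in unit_measure. f t * f t = 0)"
      by (intro integral_nonneg_eq_0_iff_AE integrable_mult_square_integrable) auto
    then show "(LINT t|unit_measure. f t * f t) = 0 \<longleftrightarrow> L2_rel f (\<lambda>_. 0)"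
      using f by (simp add: L2_rel_def square_integrable_zero)
  qed
qed (fact norm_L2_def sgn_L2_def dist_L2_def uniformity_L2_def open_L2_def)+

end


section \<open>The real Hilbert space \<open>\<ell>\<^sup>2\<close>\<close>

typedef ell2 = "{a :: nat \<Rightarrow> real. summable (\<lambda>n. (a n)\<^sup>2)}"
  by (rule exI [of _ "\<lambda>_. 0"]) simp

setup_lifting type_definition_ell2

lemma summable_mult_ell2:
  fixes a b :: "nat \<Rightarrow> real"
  assumes "summable (\<lambda>n. (a n)\<^sup>2)" "summable (\<lambda>n. (b n)\<^sup>2)"
  shows "summable (\<lambda>n. a n * b n)"
proof (rule summable_comparison_test')
  show "summable (\<lambda>n. (a n)\<^sup>2 + (b n)\<^sup>2)"
    using assms by (rule summable_add)
  fix n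
  have "2 * (\<bar>a n\<bar> * \<bar>b n\<bar>) \<le> (a n)\<^sup>2 + (b n)\<^sup>2"
    using sum_squares_bound [of "\<bar>a n\<bar>" "\<bar>b n\<bar>"] by simp
  moreover have "0 \<le> \<bar>a n\<bar> * \<bar>b n\<bar>" by simp
  ultimately show "norm (a n * b n) \<le> (a n)\<^sup>2 + (b n)\<^sup>2"
    unfolding real_norm_def abs_mult by linarith
qed

instantiation ell2 :: real_inner
begin

lift_definition zero_ell2 :: ell2 is "\<lambda>_. 0"
  by simp

lift_definition plus_ell2 :: "ell2 \<Rightarrow> ell2 \<Rightarrow> ell2" is "\<lambda>a b n. a n + b n"
proof -
  fix a b :: "nat \<Rightarrow> real"
  assume ab: "summable (\<lambda>n. (a n)\<^sup>2)" "summable (\<lambda>n. (b n)\<^sup>2)"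
  have "summable (\<lambda>n. (a n)\<^sup>2 + (b n)\<^sup>2 + 2 * (a n * b n))"
    using ab summable_mult_ell2 [OF ab] by (intro summable_add summable_mult)
  then show "summable (\<lambda>n. (a n + b n)\<^sup>2)"
    by (simp add: power2_sum mult.assoc)
qed

lift_definition uminus_ell2 :: "ell2 \<Rightarrow> ell2" is "\<lambda>a n. - a n"
  by simp

definition minus_ell2 :: "ell2 \<Rightarrow> ell2 \<Rightarrow> ell2" where "minus_ell2 x y = x + - y"

lift_definition scaleR_ell2 :: "real \<Rightarrow> ell2 \<Rightarrow> ell2" is "\<lambda>c a n. c * a n"
  by (simp add: power_mult_distrib summable_mult)

lift_definition inner_ell2 :: "ell2 \<Rightarrow> ell2 \<Rightarrow> real" is "\<lambda>a b. \<Sum>n. a n * b n" .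

definition norm_ell2 :: "ell2 \<Rightarrow> real" where "norm_ell2 x = sqrt (inner x x)"
definition sgn_ell2 :: "ell2 \<Rightarrow> ell2" where "sgn_ell2 x = inverse (norm x) *\<^sub>R x"
definition dist_ell2 :: "ell2 \<Rightarrow> ell2 \<Rightarrow> real" where "dist_ell2 x y = norm (x - y)"
definition uniformity_ell2 :: "(ell2 \<times> ell2) filter" where
  "uniformity_ell2 = (INF e\<in>{0<..}. principal {(x, y). dist x y < e})"
definition open_ell2 :: "ell2 set \<Rightarrow> bool" where
  "open_ell2 U \<longleftrightarrow> (\<forall>x\<in>U. \<forall>\<^sub>F (x', y) in uniformity. x' = x \<longrightarrow> y \<in> U)"

instance
proof
  fix x y z :: ell2 and a b :: real
  show "x + y + z = x + (y + z)" by transfer (simp add: algebra_simps)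
  show "x + y = y + x" by transfer (simp add: algebra_simps)
  show "0 + x = x" by transfer simp
  show "- x + x = 0" by transfer simp
  show "x - y = x + - y" by (simp add: minus_ell2_def)
  show "a *\<^sub>R (x + y) = a *\<^sub>R x + a *\<^sub>R y" by transfer (simp add: algebra_simps)
  show "(a + b) *\<^sub>R x = a *\<^sub>R x + b *\<^sub>R x" by transfer (simp add: algebra_simps)
  show "a *\<^sub>R b *\<^sub>R x = (a * b) *\<^sub>R x" by transfer (simp add: mult.assoc)
  show "1 *\<^sub>R x = x" by transfer simp
  show "x \<bullet> y = y \<bullet> x" by transfer (simp add: mult.commute)
  show "(x + y) \<bullet> z = x \<bullet> z + y \<bullet> z"
    by transfer (simp add: distrib_right suminf_add summable_mult_ell2)
  show "(a *\<^sub>R x) \<bullet> y = a * (x \<bullet> y)"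
    by transfer (simp add: mult.assoc suminf_mult summable_mult_ell2)
  show "0 \<le> x \<bullet> x"
    by transfer (simp add: suminf_nonneg summable_mult_ell2)
  show "x \<bullet> x = 0 \<longleftrightarrow> x = 0"
    by transfer (simp add: suminf_eq_zero_iff summable_mult_ell2 fun_eq_iff)
qed (fact norm_ell2_def sgn_ell2_def dist_ell2_def uniformity_ell2_def open_ell2_def)+

end


section \<open>The integration operator and the Hausdorff moment operator\<close>

lift_definition integration :: "L2 \<Rightarrow> L2" is "\<lambda>x s. LINT t:{0<..<s}|unit_measure. x t"
proof -
  fix x y assume xy: "L2_rel x y"
  then have [measurable]: "x \<in> borel_measurable unit_measure" "y \<in> borel_measurable unit_measure"
    and eq: "AE t in unit_measure. x t = y t"
    by (auto simp: L2_rel_def square_integrable_def)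
  have sq: "square_integrable (\<lambda>s. LINT t:{0<..<s}|unit_measure. z t)"
    if z: "square_integrable z" for z
  proof (rule square_integrable_bounded)
    have [measurable]: "z \<in> borel_measurable unit_measure"
      using z by (simp add: square_integrable_def)
    have [measurable]: "(\<lambda>t::real. t) \<in> borel_measurable unit_measure"
      by (rule measurable_restrict_space1) (auto intro: measurable_completion)
    show "(\<lambda>s. LINT t:{0<..<s}|unit_measure. z t) \<in> borel_measurable unit_measure"
      unfolding set_lebesgue_integral_def indicator_def greaterThanLessThan_iff by measurable
    have zi: "integrable unit_measure z" by (rule integrable_square_integrable [OF z])
    fix s
    show "\<bar>LINT t:{0<..<s}|unit_measure. z t\<bar> \<le> (LINT t|unit_measure. \<bar>z t\<bar>)"
      unfolding set_lebesgue_integral_def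
      by (rule integral_abs_bound [THEN order_trans], rule integral_mono')
        (use zi in \<open>auto simp: indicator_def\<close>)
  qed
  have "(LINT t:{0<..<s}|unit_measure. x t) = (LINT t:{0<..<s}|unit_measure. y t)" for s
    unfolding set_lebesgue_integral_def
  proof (rule integral_cong_AE)
    have "(\<lambda>t. indicator {0<..<s} t :: real) \<in> borel_measurable unit_measure"
      by (rule measurable_restrict_space1) (auto intro: measurable_completion)
    then show "(\<lambda>t. indicator {0<..<s} t *\<^sub>R x t) \<in> borel_measurable unit_measure"
      "(\<lambda>t. indicator {0<..<s} t *\<^sub>R y t) \<in> borel_measurable unit_measure"
      by measurable
  qed (use eq in auto)
  then show "L2_rel (\<lambda>s. LINT t:{0<..<s}|unit_measure. x t) (\<lambda>s. LINT t:{0<..<s}|unit_measure. y t)"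
    using xy sq by (simp add: L2_rel_def)
qed

lemma integral_unit_measure_power:
  "(LINT t|unit_measure. t ^ k) = 1 / (real k + 1)"
proof -
  have "(LINT t|unit_measure. t ^ k) = (LINT t|lebesgue. indicator {0<..<1} t *\<^sub>R t ^ k)"
    by (subst integral_restrict_space) auto
  also have "\<dots> = (LINT t|lborel. indicator {0<..<1} t *\<^sub>R t ^ k)"
    by (rule integral_completion) measurable
  also have "\<dots> = (LINT t|lborel. t ^ k * indicator {0..1} t)"
  proof (rule integral_cong_AE)
    have "AE t in lborel. t \<noteq> 0 \<and> t \<noteq> (1::real)"
      using AE_lborel_singleton [of 0] AE_lborel_singleton [of 1] by auto
    then show "AE t in lborel. indicator {0<..<1} t *\<^sub>R t ^ k = t ^ k * indicator {0..1::real} t"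
      by eventually_elim (auto simp: indicator_def)
  qed auto
  also have "\<dots> = 1 / (real k + 1)"
    by (subst integral_power) (auto simp: add.commute)
  finally show ?thesis .
qed

lemma square_integrable_power: "square_integrable (\<lambda>t. t ^ k)"
proof -
  have m: "(\<lambda>t::real. t ^ n) \<in> borel_measurable unit_measure" for n
    by (rule measurable_restrict_space1) (auto intro: measurable_completion)
  have "integrable unit_measure (\<lambda>t. t ^ (2 * k))"
  proof (rule unit_measure.integrable_const_bound [where B = 1])
    show "AE t in unit_measure. norm (t ^ (2 * k)) \<le> 1"
      by (rule AE_I2) (auto simp: power_le_one)
  qed (rule m)
  then show ?thesis
    using m by (simp add: square_integrable_def power_mult [symmetric] mult.commute)
qed

text \<open>Hilbert's inequality, by the Schur test with weights \<open>1 / sqrt (k + 1)\<close>.\<close>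

lemma Hilbert_row_sum:
  "(\<Sum>k<N. sqrt (real j + 1) / sqrt (real k + 1) / (real j + real k + 1)) \<le> 4"
proof -
  define g where "g k = (if k \<le> j then 2 * sqrt (real k) / sqrt (real j + 1)
     else 4 - 2 * sqrt (real j + 1) / sqrt (real k))" for k
  have step: "sqrt (real j + 1) / sqrt (real k + 1) / (real j + real k + 1) \<le> g (Suc k) - g k" for k
  proof -
    define u v w where "u = sqrt (real k)" and "v = sqrt (real k + 1)" and "w = sqrt (real j + 1)"
    have pos: "0 \<le> u" "0 < v" "0 < w" and sqs: "u\<^sup>2 = real k" "v\<^sup>2 = real k + 1" "w\<^sup>2 = real j + 1"
      and uv: "u \<le> v" by (auto simp: u_def v_def w_def)
    have "2 * v * (v - u) - 1 = (v - u)\<^sup>2"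
      using sqs by (simp add: power2_eq_square algebra_simps)
    then have a: "1 \<le> 2 * v * (v - u)"
      using zero_le_power2 [of "v - u"] by linarith
    show ?thesis
    proof (cases "k \<le> j")
      case True
      have "w / v / (real j + real k + 1) \<le> w / v / w\<^sup>2"
        using pos sqs by (intro divide_left_mono) auto
      also have "\<dots> = 1 / (v * w)"
        using pos by (simp add: power2_eq_square)
      also have "\<dots> \<le> 2 * v * (v - u) / (v * w)"
        using a pos by (intro divide_right_mono) auto
      also have "\<dots> = 2 * v / w - 2 * u / w"
        using pos by (simp add: field_simps)
      also have "\<dots> = g (Suc k) - g k"
      proof (cases "k = j")
        case True
        then show ?thesis using pos by (simp add: g_def u_def v_def w_def add.commute)
      next
        case False
        with \<open>k \<le> j\<close> show ?thesis by (simp add: g_def u_def v_def w_def add.commute)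
      qed
      finally show ?thesis by (simp add: v_def w_def)
    next
      case False
      then have u: "0 < u" by (simp add: u_def)
      have "w / v / (real j + real k + 1) \<le> w / v / v\<^sup>2"
        using pos sqs by (intro divide_left_mono) auto
      also have "\<dots> = w * 1 / (v * v\<^sup>2)" by simp
      also have "\<dots> \<le> w * (2 * v * (v - u)) / (v * v\<^sup>2)"
        using a pos by (intro divide_right_mono mult_left_mono) auto
      also have "\<dots> = w * 2 * (v - u) / (v * v)"
        using pos by (simp add: power2_eq_square)
      also have "\<dots> \<le> w * 2 * (v - u) / (u * v)"
        using pos u uv by (intro divide_left_mono mult_right_mono) auto
      also have "\<dots> = 2 * w / u - 2 * w / v"
        using pos u by (simp add: field_simps)
      also have "\<dots> = g (Suc k) - g k"
        using False by (simp add: g_def u_def v_def w_def add.commute)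
      finally show ?thesis by (simp add: v_def w_def)
    qed
  qed
  have "(\<Sum>k<N. sqrt (real j + 1) / sqrt (real k + 1) / (real j + real k + 1)) \<le> (\<Sum>k<N. g (Suc k) - g k)"
    by (intro sum_mono step)
  also have "\<dots> = g N - g 0"
    by (rule sum_lessThan_telescope)
  also have "\<dots> \<le> 4"
  proof (cases "N \<le> j")
    case True
    then have "sqrt (real N) \<le> sqrt (real j + 1)" by simp
    moreover have "0 \<le> sqrt (real j + 1)" by simp
    ultimately have "sqrt (real N) \<le> 2 * sqrt (real j + 1)" by linarith
    then show ?thesis using True by (simp add: g_def divide_le_eq)
  next
    case False
    then show ?thesis by (simp add: g_def)
  qed
  finally show ?thesis .
qed

lemma Hilbert_inequality:
  "(\<Sum>j<N. \<Sum>k<N. b j * b k / (real j + real k + 1)) \<le> 4 * (\<Sum>j<N. (b j :: real)\<^sup>2)"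
proof -
  define r where "r j k = sqrt (real j + 1) / sqrt (real k + 1) / (real j + real k + 1)" for j k
  have le: "b j * b k / (real j + real k + 1) \<le> ((b j)\<^sup>2 * r j k + (b k)\<^sup>2 * r k j) / 2" for j k
  proof -
    define p q where "p = sqrt (real j + 1)" and "q = sqrt (real k + 1)"
    have pq: "0 < p" "0 < q" by (auto simp: p_def q_def)
    have "0 \<le> (b j * p - b k * q)\<^sup>2 / (p * q)" using pq by simp
    also have "\<dots> = (b j)\<^sup>2 * (p / q) + (b k)\<^sup>2 * (q / p) - 2 * (b j * b k)"
      using pq by (simp add: power2_eq_square field_simps)
    finally have "b j * b k \<le> ((b j)\<^sup>2 * (p / q) + (b k)\<^sup>2 * (q / p)) / 2" by simp
    then have "b j * b k / (real j + real k + 1)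
        \<le> ((b j)\<^sup>2 * (p / q) + (b k)\<^sup>2 * (q / p)) / 2 / (real j + real k + 1)"
      by (intro divide_right_mono) auto
    also have "\<dots> = ((b j)\<^sup>2 * r j k + (b k)\<^sup>2 * r k j) / 2"
      by (simp add: r_def p_def q_def add_divide_distrib add_ac mult_ac)
    finally show ?thesis .
  qed
  have row: "(\<Sum>j<N. \<Sum>k<N. (b j)\<^sup>2 * r j k) \<le> 4 * (\<Sum>j<N. (b j)\<^sup>2)"
  proof -
    have "(\<Sum>j<N. \<Sum>k<N. (b j)\<^sup>2 * r j k) = (\<Sum>j<N. (b j)\<^sup>2 * (\<Sum>k<N. r j k))"
      by (simp add: sum_distrib_left)
    also have "\<dots> \<le> (\<Sum>j<N. (b j)\<^sup>2 * 4)"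
      using Hilbert_row_sum by (intro sum_mono mult_left_mono) (auto simp: r_def)
    finally show ?thesis by (simp add: sum_distrib_left mult.commute)
  qed
  have "(\<Sum>j<N. \<Sum>k<N. b j * b k / (real j + real k + 1))
      \<le> (\<Sum>j<N. \<Sum>k<N. ((b j)\<^sup>2 * r j k + (b k)\<^sup>2 * r k j) / 2)"
    by (intro sum_mono le)
  also have "\<dots> = ((\<Sum>j<N. \<Sum>k<N. (b j)\<^sup>2 * r j k) + (\<Sum>j<N. \<Sum>k<N. (b k)\<^sup>2 * r k j)) / 2"
    by (simp add: sum.distrib sum_divide_distrib [symmetric])
  also have "(\<Sum>j<N. \<Sum>k<N. (b k)\<^sup>2 * r k j) = (\<Sum>j<N. \<Sum>k<N. (b j)\<^sup>2 * r j k)"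
    by (rule sum.swap)
  finally show ?thesis using row by simp
qed

lemma summable_moments:
  assumes z: "square_integrable z"
  shows "summable (\<lambda>j. (LINT t|unit_measure. t ^ j * z t)\<^sup>2)"
proof -
  define b where "b j = (LINT t|unit_measure. t ^ j * z t)" for j
  define K where "K = (LINT t|unit_measure. (z t)\<^sup>2)"
  have iz: "integrable unit_measure (\<lambda>t. t ^ j * z t)" for j
    by (intro integrable_mult_square_integrable square_integrable_power z)
  have ip: "integrable unit_measure (\<lambda>t::real. t ^ j)" for j
    by (intro integrable_square_integrable square_integrable_power)
  have iz2: "integrable unit_measure (\<lambda>t. (z t)\<^sup>2)"
    using z by (simp add: square_integrable_def)
  have "(\<Sum>j<N. (b j)\<^sup>2) \<le> 4 * K" for N
  proof -
    define S where "S = (\<Sum>j<N. (b j)\<^sup>2)"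
    define p where "p t = (\<Sum>j<N. b j * t ^ j)" for t :: real
    have pz: "p t * z t = (\<Sum>j<N. b j * (t ^ j * z t))" for t
      by (simp add: p_def sum_distrib_right mult.assoc)
    have pp: "(p t)\<^sup>2 = (\<Sum>j<N. \<Sum>k<N. b j * b k * t ^ (j + k))" for t
      unfolding power2_eq_square p_def sum_product
      by (intro sum.cong refl) (simp add: power_add mult_ac)
    have ipz: "integrable unit_measure (\<lambda>t. p t * z t)"
      unfolding pz using iz by simp
    have ipp: "integrable unit_measure (\<lambda>t. (p t)\<^sup>2)"
      unfolding pp using ip by simp
    have "(LINT t|unit_measure. p t * z t) = S"
      unfolding pz S_def using iz by (simp add: b_def power2_eq_square)
    moreover have "(LINT t|unit_measure. (p t)\<^sup>2)
        = (\<Sum>j<N. \<Sum>k<N. b j * b k / (real j + real k + 1))"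
      unfolding pp using ip by (simp add: integral_unit_measure_power)
    then have "(LINT t|unit_measure. (p t)\<^sup>2) \<le> 4 * S"
      using Hilbert_inequality [of b N] by (simp add: S_def)
    moreover have "(LINT t|unit_measure. 8 * (p t * z t)) \<le> (LINT t|unit_measure. (p t)\<^sup>2 + 16 * (z t)\<^sup>2)"
    proof (rule integral_mono)
      fix t
      show "8 * (p t * z t) \<le> (p t)\<^sup>2 + 16 * (z t)\<^sup>2"
        using zero_le_power2 [of "p t - 4 * z t"] by (simp add: power2_diff power_mult_distrib)
    qed (use ipz ipp iz2 in auto)
    ultimately have "8 * S \<le> 4 * S + 16 * K"
      using ipz ipp iz2 by (simp add: K_def)
    then show ?thesis by (simp add: S_def)
  qed
  then have "summable (\<lambda>j. (b j)\<^sup>2)"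
    by (intro summableI_nonneg_bounded [where x = "4 * K"]) auto
  then show ?thesis by (simp add: b_def)
qed

lemma moments_cong:
  assumes "L2_rel z z'"
  shows "(LINT t|unit_measure. t ^ j * z t) = (LINT t|unit_measure. t ^ j * z' t)"
proof (rule integral_cong_AE)
  show "AE t in unit_measure. t ^ j * z t = t ^ j * z' t"
    using assms by (auto simp: L2_rel_def)
qed (use assms in \<open>intro borel_measurable_integrable integrable_mult_square_integrable
       square_integrable_power; simp add: L2_rel_def\<close>)+

text \<open>Entry \<open>j :: nat\<close> of the sequence is the moment of order \<open>j\<close>, so positions are shifted by one
  with respect to the convention \<open>j = 1, 2, \<dots>\<close>.\<close>

lift_definition Hausdorff_moment :: "L2 \<Rightarrow> ell2" is "\<lambda>z j. LINT t|unit_measure. t ^ j * z t"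
  by (intro conjI ext moments_cong summable_moments) (auto simp: L2_rel_def)


section \<open>Singular values\<close>

text \<open>\<open>singular_value_list T s\<close>: the sequence \<open>s\<close> lists, in non-increasing order, the square roots
  of the eigenvalues of \<open>T\<^sup>* T\<close>, each positive one as often as its multiplicity, that is, the
  dimension of the eigenspace. If there are only finitely many positive ones, the list is
  continued by zeros. For compact \<open>T\<close> the eigenspaces in question are finite-dimensional, so that
  \<^const>\<open>dim\<close>, which is \<open>0\<close> on infinite-dimensional spaces, is the true dimension.\<close>

definition singular_value_list :: "('a::real_inner \<Rightarrow> 'b::real_inner) \<Rightarrow> (nat \<Rightarrow> real) \<Rightarrow> bool" where
  "singular_value_list T s \<longleftrightarrow>
     decseq s \<and> (\<forall>n. 0 \<le> s n) \<and>
     (\<forall>\<mu>>0. finite {n. s n = \<mu>} \<and>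
        card {n. s n = \<mu>} = dim {x. adjoint T (T x) = \<mu>\<^sup>2 *\<^sub>R x})"

lemma singular_value_list_unique:
  assumes s: "singular_value_list T s" and t: "singular_value_list T t"
  shows "s = t"
proof -
  have False
    if s: "singular_value_list T s" and t: "singular_value_list T t"
      and less: "t n < s n" and before: "\<forall>k<n. s k = t k" for s t n
  proof -
    have "0 < s n"
      using t less by (smt (verit) singular_value_list_def)
    then have fin: "finite {k. s k = s n}" and eq: "card {k. t k = s n} = card {k. s k = s n}"
      using s t by (auto simp: singular_value_list_def)
    have "decseq t" using t by (simp add: singular_value_list_def)
    then have "t k \<le> t n" if "n \<le> k" for k
      using that by (rule decseqD)
    then have "k < n" if "t k = s n" for k
      using less that by (metis not_less)
    then have "{k. t k = s n} \<subset> {k. s k = s n}"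
      using before less by auto
    with fin eq show False
      using psubset_card_mono [of "{k. s k = s n}" "{k. t k = s n}"] by linarith
  qed
  then have "s n = t n" for n
    using s t by (induction n rule: less_induct) (metis linorder_neqE_linordered_idom)
  then show ?thesis by auto
qed

definition singular_value :: "('a::real_inner \<Rightarrow> 'b::real_inner) \<Rightarrow> nat \<Rightarrow> real" where
  \<comment> \<open>indexed from \<open>1\<close>: \<open>singular_value T 1\<close> is the largest singular value\<close>
  "singular_value T i = (THE s. singular_value_list T s) (i - 1)"

end

theory Submission
  imports Defs
begin

text \<open>Let \<open>T = B\<^sup>(\<^sup>H\<^sup>) \<circ> J\<close>. Fubini's theorem gives
  \<open>(T x)\<^sub>j = (\<langle>x, t\<^sup>0\<rangle> - \<langle>x, t\<^sup>j\<^sup>+\<^sup>1\<rangle>) / (j + 1)\<close>, from which compactness and the adjoint are read off.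
  Successive maximisation of \<open>\<parallel>T x\<parallel> / \<parallel>x\<parallel>\<close> produces the eigenvectors of \<open>T\<^sup>* T\<close> and, with them, the two
  halves of the min-max principle.

  Upper bound: if \<open>x\<close> is orthogonal to \<open>1, t, \<dots>, t\<^sup>n\<^sup>-\<^sup>1\<close>, then the entries of \<open>T x\<close> with \<open>j + 1 < n\<close> vanish
  and the others are moments of \<open>x\<close> divided by at least \<open>n\<close>, so Hilbert's inequality yields
  \<open>\<parallel>T x\<parallel> \<le> 2 \<parallel>x\<parallel> / n\<close>.

  Lower bound: on the span of the monomials \<open>t\<^sup>p\<^sup>-\<^sup>1\<close> with \<open>2 p + 1 = 81, 81\<^sup>2, \<dots>, 81\<^sup>n\<close>, the rows \<open>j = p\<close> of
  \<open>T x\<close> form the Gram matrix of the \<open>t\<^sup>p\<close> applied to the coefficients of \<open>J x\<close>. Scaled to unit diagonal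
  it is diagonally dominant, and all scaling factors are at most exponential in \<open>n\<close>.\<close>

section \<open>Underdetermined homogeneous linear systems\<close>

text \<open>Gaussian elimination, by induction on the number of equations. If the last equation has
  a nonzero coefficient at \<open>p\<close>, it is used to eliminate the unknown \<open>p\<close>
  from the others, and back-substitution recovers that unknown as \<open>- s / a n p\<close>. The
  unknowns range over an arbitrary finite set so that \<open>p\<close> can be removed from
  it.\<close>

lemma homogeneous_system_nontrivial_solution:
  fixes a :: "nat \<Rightarrow> 'k \<Rightarrow> real"
  assumes "finite K" "n < card K"
  shows "\<exists>c. (\<exists>k\<in>K. c k \<noteq> 0) \<and> (\<forall>i<n. (\<Sum>k\<in>K. a i k * c k) = 0)"
  using assms
proof (induction n arbitrary: a K)
  case 0
  then have "K \<noteq> {}" by auto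
  then show ?case by (intro exI[of _ "\<lambda>_. 1"]) auto
next
  case (Suc n)
  show ?case
  proof (cases "\<forall>k\<in>K. a n k = 0")
    case True
    obtain c where c: "\<exists>k\<in>K. c k \<noteq> 0" "\<forall>i<n. (\<Sum>k\<in>K. a i k * c k) = 0"
      using Suc.IH[of K a] Suc.prems by auto
    have "(\<Sum>k\<in>K. a i k * c k) = 0" if "i < Suc n" for i
      using that c(2) True by (cases "i = n") auto
    then show ?thesis using c(1) by blast
  next
    case False
    then obtain p where p: "p \<in> K" "a n p \<noteq> 0" by blast
    define K' where "K' = K - {p}"
    have K': "finite K'" "n < card K'" "p \<notin> K'" "K = insert p K'"
      using Suc.prems p by (auto simp: K'_def)
    obtain c where c: "\<exists>k\<in>K'. c k \<noteq> 0"
      "\<forall>i<n. (\<Sum>k\<in>K'. (a i k - a i p * a n k / a n p) * c k) = 0"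
      using Suc.IH[of K' "\<lambda>i k. a i k - a i p * a n k / a n p"] K' by blast
    define s where "s = (\<Sum>k\<in>K'. a n k * c k)"
    define d where "d = c(p := - s / a n p)"
    have sum: "(\<Sum>k\<in>K. a i k * d k) = (\<Sum>k\<in>K'. a i k * c k) - a i p * s / a n p" for i
    proof -
      have "(\<Sum>k\<in>K'. a i k * d k) = (\<Sum>k\<in>K'. a i k * c k)"
        using K' by (intro sum.cong) (auto simp: d_def)
      then show ?thesis using K' by (simp add: d_def)
    qed
    have "(\<Sum>k\<in>K. a i k * d k) = 0" if "i < Suc n" for i
    proof (cases "i = n")
      case True
      then show ?thesis using p by (simp add: sum s_def)
    next
      case False
      then have "0 = (\<Sum>k\<in>K'. (a i k - a i p * a n k / a n p) * c k)"
        using c(2) that by simp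
      also have "\<dots> = (\<Sum>k\<in>K'. a i k * c k) - a i p * s / a n p"
        by (simp add: s_def algebra_simps sum_subtractf sum_distrib_left sum_divide_distrib)
      finally show ?thesis by (simp add: sum)
    qed
    moreover have "\<exists>k\<in>K. d k \<noteq> 0"
      using c(1) K' by (auto simp: d_def)
    ultimately show ?thesis by blast
  qed
qed

section \<open>Compact operators with an adjoint: existence of maximising eigenvectors\<close>

text \<open>The adjoint is a parameter because on bare inner product spaces a bounded operator need
  not have one. \<open>adjoint_T\<close> identifies \<open>S\<close> with the operator occurring in
  \<open>singular_value_list\<close>.\<close>

locale compact_operator_adjoint =
  fixes T :: "'a::real_inner \<Rightarrow> 'b::real_inner" and S :: "'b \<Rightarrow> 'a"
  assumes bounded_T: "bounded_linear T"
    and T_inner: "\<And>x y. T x \<bullet> y = x \<bullet> S y"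
    and compact_T: "\<And>x :: nat \<Rightarrow> 'a. (\<And>n. norm (x n) \<le> 1) \<Longrightarrow>
      \<exists>r l. strict_mono r \<and> (\<lambda>n. T (x (r n))) \<longlonglongrightarrow> l"
begin

interpretation T: bounded_linear T by (rule bounded_T)

lemma adjoint_T: "adjoint T = S"
  by (rule adjoint_unique) (simp add: T_inner)

lemma S_inner: "S y \<bullet> x = y \<bullet> T x"
  by (metis T_inner inner_commute)

lemma linear_S: "linear S"
  by (rule linearI)
    (simp_all add: vector_eq_ldot[symmetric] T_inner[symmetric] inner_add_right)

lemma bounded_S: "bounded_linear S"
proof -
  obtain K where K: "\<And>x. norm (T x) \<le> norm x * K" "0 \<le> K" using T.nonneg_bounded by blast
  have "norm (S y) \<le> norm y * K" for y
  proof (cases "norm (S y) = 0")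
    case True
    then show ?thesis using K(2) by simp
  next
    case False
    have "norm (S y) * norm (S y) = y \<bullet> T (S y)"
      by (metis S_inner power2_norm_eq_inner power2_eq_square)
    also have "\<dots> \<le> norm y * norm (T (S y))" by (rule norm_cauchy_schwarz)
    also have "\<dots> \<le> norm y * (norm (S y) * K)" by (intro mult_left_mono K) simp
    finally show ?thesis using False by (simp add: mult.commute mult.left_commute)
  qed
  then show ?thesis
    using linear_S by (intro bounded_linear_intro[of _ K]) (auto simp: linear_iff)
qed

interpretation S: bounded_linear S by (rule bounded_S)

lemma norm_T_sq: "(norm (T x))\<^sup>2 = S (T x) \<bullet> x"
  by (simp add: S_inner power2_norm_eq_inner)

text \<open>Completeness of the domain is not needed: along a maximising sequence \<open>x n\<close> the vectors
  \<open>S (T (x n))\<close> have a convergent subsequence, and they approach \<open>l\<^sup>2 *\<^sub>R x n\<close> with \<open>l\<close> the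
  supremum.\<close>

lemma maximiser_exists:
  assumes E: "\<And>e. e \<in> E \<Longrightarrow> \<exists>\<mu>. S (T e) = \<mu> *\<^sub>R e"
    and x0: "\<And>e. e \<in> E \<Longrightarrow> x0 \<bullet> e = 0" "T x0 \<noteq> 0"
  shows "\<exists>u. norm u = 1 \<and> T u \<noteq> 0 \<and> (\<forall>e\<in>E. u \<bullet> e = 0) \<and> S (T u) = (norm (T u))\<^sup>2 *\<^sub>R u \<and>
    (\<forall>x. (\<forall>e\<in>E. x \<bullet> e = 0) \<longrightarrow> norm (T x) \<le> norm (T u) * norm x)"
proof -
  define V where "V = {x. \<forall>e\<in>E. x \<bullet> e = 0}"
  have V_scale: "c *\<^sub>R x \<in> V" if "x \<in> V" for c x using that by (auto simp: V_def)
  \<comment> \<open>The composition of \<open>S\<close> and \<open>T\<close> is symmetric and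
    \<open>E\<close> consists of its eigenvectors, so the orthogonal complement of \<open>E\<close>
    is invariant.\<close>
  have V_inv: "S (T x) \<in> V" if "x \<in> V" for x
    using that E by (force simp: V_def S_inner T_inner)
  define N where "N = {norm (T x) |x. x \<in> V \<and> norm x \<le> 1}"
  obtain K where K: "\<And>x. norm (T x) \<le> norm x * K" "K \<ge> 0" using T.nonneg_bounded by blast
  have "norm (T x) \<le> K" if "norm x \<le> 1" for x
    using K(1)[of x] mult_right_mono[OF that K(2)] by simp
  then have bdd: "bdd_above N" by (auto simp: N_def intro!: bdd_aboveI[of _ K])
  have "0 \<in> V" by (simp add: V_def)
  then have "norm (T 0) \<in> N" unfolding N_def by force
  then have ne: "N \<noteq> {}" by blast
  define l where "l = Sup N"
  have T_le: "norm (T x) \<le> l * norm x" if "x \<in> V" for x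
  proof (cases "x = 0")
    case False
    have "norm (T ((1 / norm x) *\<^sub>R x)) \<in> N"
      using V_scale[OF that] False unfolding N_def by fastforce
    then have "norm (T ((1 / norm x) *\<^sub>R x)) \<le> l"
      unfolding l_def by (rule cSup_upper[OF _ bdd])
    then show ?thesis using False by (simp add: T.scaleR divide_simps mult.commute)
  qed simp
  have x0V: "x0 \<in> V" using x0 by (auto simp: V_def)
  have "x0 \<noteq> 0" using x0(2) by auto
  then have l: "l > 0"
    using T_le[OF x0V] x0(2) mult_nonpos_nonneg[of l "norm x0"]
    by (metis norm_ge_zero norm_le_zero_iff not_le order_trans)
  have "\<exists>x\<in>V. norm x \<le> 1 \<and> l - 1 / real (Suc n) < norm (T x)" for n
  proof -
    have "l - 1 / real (Suc n) < Sup N" by (simp add: l_def)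
    then obtain y where "y \<in> N" "l - 1 / real (Suc n) < y" using less_cSupD[OF ne] by blast
    then show ?thesis by (auto simp: N_def)
  qed
  then obtain x where x: "\<And>n. x n \<in> V" "\<And>n. norm (x n) \<le> 1"
    "\<And>n. l - 1 / real (Suc n) < norm (T (x n))" by metis
  have Tx_le: "norm (T (x n)) \<le> l" for n
    using T_le[OF x(1), of n] mult_left_mono[OF x(2), of l n] l by linarith
  have lim: "(\<lambda>n. norm (T (x n))) \<longlonglongrightarrow> l"
  proof (rule tendsto_sandwich)
    show "(\<lambda>n. l - 1 / real (Suc n)) \<longlonglongrightarrow> l"
      using tendsto_diff[OF tendsto_const LIMSEQ_Suc[OF lim_const_over_n[of 1]], of l] by simp
  qed (use x(3) Tx_le in \<open>auto simp: less_imp_le\<close>)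
  \<comment> \<open>Expanding the square gives two square terms, each at most \<open>l^4\<close>,
    and the mixed term, which is exactly the subtracted one. The bound \<open>l\<^sup>2\<close> on
    the norm of \<open>S (T (x n))\<close> comes from applying \<open>T_le\<close> to that vector,
    which lies in \<open>V\<close> by invariance.\<close>
  have defect: "(norm (S (T (x n)) - l\<^sup>2 *\<^sub>R x n))\<^sup>2 \<le> 2 * l^4 - 2 * l\<^sup>2 * (norm (T (x n)))\<^sup>2" for n
  proof -
    let ?a = "S (T (x n))"
    have "norm ?a * norm ?a = T ?a \<bullet> T (x n)"
      by (metis T_inner power2_norm_eq_inner power2_eq_square)
    also have "\<dots> \<le> norm (T ?a) * norm (T (x n))" by (rule norm_cauchy_schwarz)
    also have "\<dots> \<le> (l * norm ?a) * l"
      by (intro mult_mono T_le V_inv x Tx_le) (use l in auto)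
    finally have "norm ?a \<le> l\<^sup>2"
      using l by (cases "norm ?a = 0") (simp_all add: power2_eq_square mult.commute)
    then have "(norm ?a)\<^sup>2 \<le> (l\<^sup>2)\<^sup>2" by (intro power_mono) auto
    moreover have "(l\<^sup>2 * norm (x n))\<^sup>2 \<le> (l\<^sup>2 * 1)\<^sup>2"
      using x(2) by (intro power_mono mult_left_mono) auto
    moreover have "(norm (?a - l\<^sup>2 *\<^sub>R x n))\<^sup>2
        = (norm ?a)\<^sup>2 - 2 * l\<^sup>2 * (?a \<bullet> x n) + (l\<^sup>2 * norm (x n))\<^sup>2"
      by (simp add: power2_norm_eq_inner inner_diff power_mult_distrib inner_commute algebra_simps
          power2_eq_square[of "l\<^sup>2"])
    ultimately show ?thesis by (simp add: norm_T_sq)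
  qed
  have "(\<lambda>n. 2 * l^4 - 2 * l\<^sup>2 * (norm (T (x n)))\<^sup>2) \<longlonglongrightarrow> 2 * l^4 - 2 * l\<^sup>2 * l\<^sup>2"
    by (intro tendsto_intros lim)
  moreover have "2 * l^4 - 2 * l\<^sup>2 * l\<^sup>2 = 0" by (simp add: power2_eq_square power4_eq_xxxx)
  ultimately have upper: "(\<lambda>n. 2 * l^4 - 2 * l\<^sup>2 * (norm (T (x n)))\<^sup>2) \<longlonglongrightarrow> 0"
    by (simp only:)
  have "(\<lambda>n. (norm (S (T (x n)) - l\<^sup>2 *\<^sub>R x n))\<^sup>2) \<longlonglongrightarrow> 0"
    by (rule tendsto_sandwich[OF _ _ tendsto_const upper]) (intro always_eventually allI defect zero_le_power2)+
  then have d0: "(\<lambda>n. S (T (x n)) - l\<^sup>2 *\<^sub>R x n) \<longlonglongrightarrow> 0"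
    using tendsto_real_sqrt[of "\<lambda>n. (norm (S (T (x n)) - l\<^sup>2 *\<^sub>R x n))\<^sup>2" 0]
    by (simp add: tendsto_norm_zero_iff)
  obtain r y where r: "strict_mono r" "(\<lambda>n. T (x (r n))) \<longlonglongrightarrow> y"
    using compact_T x(2) by blast
  \<comment> \<open>Along the subsequence \<open>S (T (x (r n)))\<close> tends to
    \<open>S y\<close>, and the defect tends to 0, so this is the only possible limit of
    \<open>x (r n)\<close>.\<close>
  define u where "u = (1 / l\<^sup>2) *\<^sub>R S y"
  have "(\<lambda>n. S (T (x (r n))) - l\<^sup>2 *\<^sub>R x (r n)) \<longlonglongrightarrow> 0"
    using LIMSEQ_subseq_LIMSEQ[OF d0 r(1)] by (simp add: o_def)
  from tendsto_diff[OF S.tendsto[OF r(2)] this]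
  have "(\<lambda>n. l\<^sup>2 *\<^sub>R x (r n)) \<longlonglongrightarrow> S y" by simp
  from tendsto_scaleR[OF tendsto_const[of "1 / l\<^sup>2"] this]
  have xu: "(\<lambda>n. x (r n)) \<longlonglongrightarrow> u" using l by (simp add: u_def)
  have uV: "u \<in> V"
    unfolding V_def
  proof safe
    fix e assume "e \<in> E"
    then have "(\<lambda>n. x (r n) \<bullet> e) = (\<lambda>n. 0)" using x(1) by (auto simp: V_def)
    moreover have "(\<lambda>n. x (r n) \<bullet> e) \<longlonglongrightarrow> u \<bullet> e" by (intro tendsto_intros xu)
    ultimately show "u \<bullet> e = 0" using LIMSEQ_unique tendsto_const by metis
  qed
  have "(\<lambda>n. norm (T (x (r n)))) \<longlonglongrightarrow> norm (T u)"
    by (intro tendsto_norm T.tendsto xu)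
  moreover have "(\<lambda>n. norm (T (x (r n)))) \<longlonglongrightarrow> l"
    using LIMSEQ_subseq_LIMSEQ[OF lim r(1)] by (simp add: o_def)
  ultimately have Tu: "norm (T u) = l" by (rule LIMSEQ_unique)
  have "norm u \<le> 1"
    by (rule LIMSEQ_le_const2[OF tendsto_norm[OF xu]]) (use x(2) in auto)
  moreover have "1 \<le> norm u" using T_le[OF uV] Tu l by simp
  moreover have "S (T u) = l\<^sup>2 *\<^sub>R u"
  proof -
    have "T u = y" by (rule LIMSEQ_unique[OF T.tendsto[OF xu] r(2)])
    then show ?thesis using l by (simp add: u_def)
  qed
  ultimately show ?thesis
    using Tu l uV T_le by (intro exI[of _ u]) (auto simp: V_def)
qed

end

section \<open>Right singular systems and the min-max principle\<close>

text \<open>Injectivity of \<open>T\<close> on spaces of every finite dimension guarantees that the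
  successive maximisation never stops, so that the singular vectors form a sequence indexed by all
  natural numbers.\<close>

locale infinite_rank_compact_operator = compact_operator_adjoint T S
  for T :: "'a::real_inner \<Rightarrow> 'b::real_inner" and S +
  assumes infinite_rank:
    "\<And>n. \<exists>v :: nat \<Rightarrow> 'a. \<forall>c. (\<exists>k\<le>n. c k \<noteq> 0) \<longrightarrow> T (\<Sum>k\<le>n. c k *\<^sub>R v k) \<noteq> 0"
begin

interpretation T: bounded_linear T by (rule bounded_T)

interpretation S: bounded_linear S by (rule bounded_S)

text \<open>There are \<open>n\<close> equations for \<open>n + 1\<close> coefficients. This
  dimension count drives the recursive construction of singular vectors and both halves of the
  min-max principle.\<close>

lemma combination_orthogonal:
  fixes v f :: "nat \<Rightarrow> 'a"
  shows "\<exists>c. (\<exists>k\<le>n. c k \<noteq> 0) \<and> (\<forall>i<n. (\<Sum>k\<le>n. c k *\<^sub>R v k) \<bullet> f i = 0)"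
  using homogeneous_system_nontrivial_solution[of "{..n}" n "\<lambda>i k. v k \<bullet> f i"]
  by (auto simp: inner_sum_left mult.commute Bex_def)

text \<open>The last conjunct distinguishes the system from an arbitrary orthonormal family of
  eigenvectors: it forces the non-increasing order, and together with compactness it ensures that no
  positive eigenvalue is missed.\<close>

definition right_singular_system :: "(nat \<Rightarrow> 'a) \<Rightarrow> bool" where
  "right_singular_system e \<longleftrightarrow> (\<forall>n. norm (e n) = 1 \<and> T (e n) \<noteq> 0 \<and> (\<forall>k<n. e n \<bullet> e k = 0) \<and>
     S (T (e n)) = (norm (T (e n)))\<^sup>2 *\<^sub>R e n \<and>
     (\<forall>x. (\<forall>k<n. x \<bullet> e k = 0) \<longrightarrow> norm (T x) \<le> norm (T (e n)) * norm x))"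

text \<open>Dependent choice. At each stage \<open>infinite_rank\<close> and
  \<open>combination_orthogonal\<close> yield a vector outside the kernel of \<open>T\<close> and
  orthogonal to the earlier choices, so \<open>maximiser_exists\<close> applies.\<close>

lemma right_singular_system_exists: "\<exists>e. right_singular_system e"
  unfolding right_singular_system_def
proof (rule dependent_wellorder_choice)
  fix n :: nat and e :: "nat \<Rightarrow> 'a"
  have image: "(\<forall>y\<in>e ` {..<n}. Q y) \<longleftrightarrow> (\<forall>k<n. Q (e k))" for Q by auto
  assume "\<And>k. k < n \<Longrightarrow> norm (e k) = 1 \<and> T (e k) \<noteq> 0 \<and> (\<forall>j<k. e k \<bullet> e j = 0) \<and>
     S (T (e k)) = (norm (T (e k)))\<^sup>2 *\<^sub>R e k \<and>
     (\<forall>x. (\<forall>j<k. x \<bullet> e j = 0) \<longrightarrow> norm (T x) \<le> norm (T (e k)) * norm x)"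
  then have E: "\<exists>\<mu>. S (T y) = \<mu> *\<^sub>R y" if "y \<in> e ` {..<n}" for y
    using that by auto
  obtain v :: "nat \<Rightarrow> 'a" where v: "\<forall>c. (\<exists>k\<le>n. c k \<noteq> 0) \<longrightarrow> T (\<Sum>k\<le>n. c k *\<^sub>R v k) \<noteq> 0"
    using infinite_rank by blast
  obtain c where c: "\<exists>k\<le>n. c k \<noteq> 0" "\<forall>i<n. (\<Sum>k\<le>n. c k *\<^sub>R v k) \<bullet> e i = 0"
    using combination_orthogonal by blast
  have "T (\<Sum>k\<le>n. c k *\<^sub>R v k) \<noteq> 0" using v c(1) by blast
  then have "\<exists>u. norm u = 1 \<and> T u \<noteq> 0 \<and> (\<forall>y\<in>e ` {..<n}. u \<bullet> y = 0) \<and>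
      S (T u) = (norm (T u))\<^sup>2 *\<^sub>R u \<and>
      (\<forall>x. (\<forall>y\<in>e ` {..<n}. x \<bullet> y = 0) \<longrightarrow> norm (T x) \<le> norm (T u) * norm x)"
    by (intro maximiser_exists[OF E]) (use c(2) in auto)
  then show "\<exists>u. norm u = 1 \<and> T u \<noteq> 0 \<and> (\<forall>k<n. u \<bullet> e k = 0) \<and>
      S (T u) = (norm (T u))\<^sup>2 *\<^sub>R u \<and>
      (\<forall>x. (\<forall>k<n. x \<bullet> e k = 0) \<longrightarrow> norm (T x) \<le> norm (T u) * norm x)"
    unfolding image .
qed simp

context
  fixes e :: "nat \<Rightarrow> 'a"
  assumes e: "right_singular_system e"
begin

lemma e_eigen: "S (T (e n)) = (norm (T (e n)))\<^sup>2 *\<^sub>R e n"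
  and norm_e: "norm (e n) = 1"
  and e_max: "(\<And>k. k < n \<Longrightarrow> x \<bullet> e k = 0) \<Longrightarrow> norm (T x) \<le> norm (T (e n)) * norm x"
  using e by (auto simp: right_singular_system_def)

lemma e_nonzero: "0 \<noteq> e n"
  using norm_e[of n] by auto

lemma e_orthonormal: "e m \<bullet> e n = (if m = n then 1 else 0)"
proof (cases m n rule: linorder_cases)
  case equal
  then show ?thesis using norm_e[of n] by (simp add: norm_eq_1)
next
  case less
  then show ?thesis
    using e inner_commute[of "e m" "e n"] by (simp add: right_singular_system_def)
qed (use e in \<open>simp add: right_singular_system_def\<close>)

lemma T_e_orthogonal: "T (e m) \<bullet> T (e n) = (if m = n then (norm (T (e n)))\<^sup>2 else 0)"
  by (auto simp: T_inner e_eigen e_orthonormal)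

lemma inner_sum_e: "finite K \<Longrightarrow> (\<Sum>k\<in>K. c k *\<^sub>R e k) \<bullet> e m = (if m \<in> K then c m else 0)"
  by (simp add: inner_sum_left e_orthonormal if_distrib[of "\<lambda>x. _ * x"] cong: if_cong)

lemma decseq_norm_T_e: "decseq (\<lambda>n. norm (T (e n)))"
proof (rule decseq_SucI)
  fix n
  show "norm (T (e (Suc n))) \<le> norm (T (e n))"
    using e_max[of n "e (Suc n)"] by (simp add: e_orthonormal norm_e)
qed

text \<open>The images \<open>T (e n)\<close> are pairwise orthogonal, so by Pythagoras the distance
  between two of them is at least the norm of either. Along a convergent subsequence consecutive
  distances tend to 0, hence so do the norms; monotonicity extends this to the whole
  sequence.\<close>

lemma norm_T_e_tendsto_0: "(\<lambda>n. norm (T (e n))) \<longlonglongrightarrow> 0"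
proof -
  obtain r y where r: "strict_mono r" "(\<lambda>n. T (e (r n))) \<longlonglongrightarrow> y"
    using compact_T[of e] by (metis norm_e order_refl)
  have "(\<lambda>n. T (e (r (Suc n))) - T (e (r n))) \<longlonglongrightarrow> y - y"
    by (intro tendsto_diff r(2) LIMSEQ_Suc)
  then have upper: "(\<lambda>n. norm (T (e (r (Suc n))) - T (e (r n)))) \<longlonglongrightarrow> 0"
    by (intro tendsto_norm_zero) simp
  have step: "norm (T (e (r n))) \<le> norm (T (e (r (Suc n))) - T (e (r n)))" for n
  proof (rule power2_le_imp_le)
    have "r (Suc n) \<noteq> r n" using r(1) by (metis n_not_Suc_n strict_mono_eq)
    then have "(norm (T (e (r (Suc n))) - T (e (r n))))\<^sup>2
        = (norm (T (e (r (Suc n)))))\<^sup>2 + (norm (T (e (r n))))\<^sup>2"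
      by (simp add: power2_norm_eq_inner[of "_ - _"] inner_diff T_e_orthogonal)
    then show "(norm (T (e (r n))))\<^sup>2 \<le> (norm (T (e (r (Suc n))) - T (e (r n))))\<^sup>2" by simp
  qed simp
  have sub: "(\<lambda>n. norm (T (e (r n)))) \<longlonglongrightarrow> 0"
    by (rule tendsto_sandwich[OF _ _ tendsto_const upper]) (intro always_eventually allI step norm_ge_zero)+
  obtain l where l: "(\<lambda>n. norm (T (e n))) \<longlonglongrightarrow> l"
    by (rule decseq_convergent[OF decseq_norm_T_e, of 0]) auto
  show ?thesis
    using LIMSEQ_unique[OF LIMSEQ_subseq_LIMSEQ[OF l r(1), unfolded o_def] sub] l by simp
qed

lemma finite_norm_T_e_eq: "0 < \<mu> \<Longrightarrow> finite {n. norm (T (e n)) = \<mu>}"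
proof -
  assume "0 < \<mu>"
  then have "\<forall>\<^sub>F n in sequentially. norm (T (e n)) < \<mu>"
    using norm_T_e_tendsto_0 by (auto intro: order_tendstoD)
  then obtain N where "\<And>n. n \<ge> N \<Longrightarrow> norm (T (e n)) < \<mu>"
    by (auto simp: eventually_sequentially)
  then have "{n. norm (T (e n)) = \<mu>} \<subseteq> {..<N}" by (force simp: not_le[symmetric])
  then show ?thesis using finite_subset by blast
qed

text \<open>Let \<open>y\<close> be an eigenvector minus its projection onto the span. It is
  orthogonal to every \<open>e n\<close>: by construction if the eigenvalues agree, by symmetry if
  they differ. Then \<open>e_max\<close> bounds \<open>T y\<close> by a null sequence, so
  \<open>T y = 0\<close>, and the eigenvalue equation with positive \<open>\<mu>\<close> forces
  \<open>y = 0\<close>.\<close>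

lemma eigenspace_eq_span:
  assumes "0 < \<mu>"
  shows "{x. S (T x) = \<mu>\<^sup>2 *\<^sub>R x} = span (e ` {n. norm (T (e n)) = \<mu>})" (is "?L = span (e ` ?K)")
proof
  have "e ` ?K \<subseteq> ?L" using e_eigen by auto
  moreover have "subspace ?L"
    by (auto simp: subspace_def T.zero S.zero T.add S.add T.scaleR S.scaleR algebra_simps)
  ultimately show "span (e ` ?K) \<subseteq> ?L" by (simp add: span_minimal)
  show "?L \<subseteq> span (e ` ?K)"
  proof
    fix x assume "x \<in> ?L"
    then have x: "S (T x) = \<mu>\<^sup>2 *\<^sub>R x" by simp
    define p where "p = (\<Sum>k\<in>?K. (x \<bullet> e k) *\<^sub>R e k)"
    define y where "y = x - p"
    have fin: "finite ?K" by (rule finite_norm_T_e_eq[OF assms])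
    have p: "p \<in> span (e ` ?K)"
      unfolding p_def by (intro span_sum span_scale span_base) auto
    have orth: "y \<bullet> e n = 0" for n
    proof (cases "n \<in> ?K")
      case True
      then show ?thesis by (simp add: y_def inner_diff_left p_def inner_sum_e fin)
    next
      case False
      have "(norm (T (e n)))\<^sup>2 * (x \<bullet> e n) = x \<bullet> S (T (e n))" by (simp add: e_eigen)
      also have "\<dots> = S (T x) \<bullet> e n" by (simp add: T_inner[symmetric] S_inner)
      also have "\<dots> = \<mu>\<^sup>2 * (x \<bullet> e n)" by (simp add: x)
      finally have "x \<bullet> e n = 0" using False assms by (auto simp: power2_eq_iff_nonneg)
      then show ?thesis using False by (simp add: y_def inner_diff_left p_def inner_sum_e fin)
    qed
    have "norm (T y) \<le> norm (T (e n)) * norm y" for n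
      by (intro e_max orth)
    moreover have "(\<lambda>n. norm (T (e n)) * norm y) \<longlonglongrightarrow> 0 * norm y"
      by (intro tendsto_mult norm_T_e_tendsto_0 tendsto_const)
    ultimately have "norm (T y) \<le> 0 * norm y"
      by (intro LIMSEQ_le_const) auto
    then have "S (T y) = 0" by (simp add: S.zero)
    moreover have "S (T p) = \<mu>\<^sup>2 *\<^sub>R p"
      using p \<open>span (e ` ?K) \<subseteq> ?L\<close> by blast
    then have "S (T y) = \<mu>\<^sup>2 *\<^sub>R y"
      by (simp add: y_def T.diff S.diff scaleR_diff_right x)
    ultimately have "\<mu>\<^sup>2 *\<^sub>R y = 0" by simp
    then show "x \<in> span (e ` ?K)" using assms p by (simp add: y_def)
  qed
qed

lemma singular_value_list_norm_T_e: "singular_value_list T (\<lambda>n. norm (T (e n)))"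
  unfolding singular_value_list_def adjoint_T
proof (intro conjI allI impI decseq_norm_T_e norm_ge_zero finite_norm_T_e_eq)
  fix \<mu> :: real assume \<mu>: "\<mu> > 0"
  let ?K = "{n. norm (T (e n)) = \<mu>}"
  have "inj_on e ?K"
  proof (rule inj_onI)
    fix m n assume "e m = e n"
    then have "e m \<bullet> e n = 1" using e_orthonormal[of n n] by simp
    then show "m = n" by (simp add: e_orthonormal split: if_splits)
  qed
  moreover have "independent (e ` ?K)"
  proof (rule pairwise_orthogonal_independent)
    show "pairwise orthogonal (e ` ?K)"
      by (auto simp: pairwise_def orthogonal_def e_orthonormal)
    show "0 \<notin> e ` ?K" using e_nonzero by (auto simp only: image_iff)
  qed
  ultimately show "card ?K = dim {x. S (T x) = \<mu>\<^sup>2 *\<^sub>R x}"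
    unfolding eigenspace_eq_span[OF \<mu>] dim_span
    by (simp add: dim_eq_card_independent card_image)
qed

lemma singular_value_eq: "singular_value T (Suc n) = norm (T (e n))"
proof -
  have "(THE s. singular_value_list T s) = (\<lambda>n. norm (T (e n)))"
    by (intro the_equality singular_value_list_norm_T_e)
      (rule singular_value_list_unique[OF _ singular_value_list_norm_T_e])
  then show ?thesis by (simp add: singular_value_def)
qed

end

text \<open>The span of \<open>n + 1\<close> vectors contains a nonzero vector orthogonal to
  \<open>e 0\<close>, ..., \<open>e (n - 1)\<close>, and there \<open>T\<close> stretches by at most
  \<open>norm (T (e n))\<close>. The latter is singular value number \<open>Suc n\<close>, since
  \<open>e\<close> is indexed from 0.\<close>

theorem singular_value_ge:
  fixes v :: "nat \<Rightarrow> 'a"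
  assumes "\<And>c. \<exists>k\<le>n. c k \<noteq> 0 \<Longrightarrow> T (\<Sum>k\<le>n. c k *\<^sub>R v k) \<noteq> 0"
    and "\<And>c. \<delta> * norm (\<Sum>k\<le>n. c k *\<^sub>R v k) \<le> norm (T (\<Sum>k\<le>n. c k *\<^sub>R v k))"
  shows "\<delta> \<le> singular_value T (Suc n)"
proof -
  obtain e where e: "right_singular_system e" using right_singular_system_exists by blast
  obtain c where c: "\<exists>k\<le>n. c k \<noteq> 0" "\<forall>i<n. (\<Sum>k\<le>n. c k *\<^sub>R v k) \<bullet> e i = 0"
    using combination_orthogonal by blast
  let ?x = "\<Sum>k\<le>n. c k *\<^sub>R v k"
  have "\<delta> * norm ?x \<le> norm (T ?x)" by (rule assms)
  also have "\<dots> \<le> norm (T (e n)) * norm ?x" using c(2) by (intro e_max[OF e]) auto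
  finally have "\<delta> * norm ?x \<le> norm (T (e n)) * norm ?x" .
  moreover have "norm ?x > 0" using assms(1)[OF c(1)] by (auto simp: T.zero)
  ultimately show ?thesis by (simp add: singular_value_eq[OF e])
qed

text \<open>The dual count: some nonzero combination of \<open>e 0\<close>, ..., \<open>e n\<close>
  is orthogonal to all \<open>f k\<close> with \<open>k < n\<close>, and on this span
  \<open>T\<close> stretches by at least \<open>norm (T (e n))\<close>, because the images of the
  \<open>e k\<close> are orthogonal and their norms decrease.\<close>

theorem singular_value_le:
  fixes f :: "nat \<Rightarrow> 'a"
  assumes "\<And>x. (\<And>k. k < n \<Longrightarrow> x \<bullet> f k = 0) \<Longrightarrow> norm (T x) \<le> \<epsilon> * norm x"
  shows "singular_value T (Suc n) \<le> \<epsilon>"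
proof -
  obtain e where e: "right_singular_system e" using right_singular_system_exists by blast
  obtain c where c: "\<exists>k\<le>n. c k \<noteq> 0" "\<forall>i<n. (\<Sum>k\<le>n. c k *\<^sub>R e k) \<bullet> f i = 0"
    using combination_orthogonal by blast
  let ?x = "\<Sum>k\<le>n. c k *\<^sub>R e k"
  have x: "(norm ?x)\<^sup>2 = (\<Sum>k\<le>n. (c k)\<^sup>2)"
    by (simp add: power2_norm_eq_inner inner_sum_right inner_sum_e[OF e] power2_eq_square[of "c _"])
  have "(norm (T ?x))\<^sup>2 = (\<Sum>k\<le>n. (c k)\<^sup>2 * (norm (T (e k)))\<^sup>2)"
    unfolding power2_norm_eq_inner[of "T ?x"]
    unfolding T.sum T.scaleR
    by (simp add: inner_sum_left inner_sum_right T_e_orthogonal[OF e]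
        power2_eq_square[of "c _"] if_distrib[of "\<lambda>x. _ * x"] mult.assoc cong: if_cong)
  moreover have "(norm (T (e n)))\<^sup>2 * (norm ?x)\<^sup>2 \<le> (\<Sum>k\<le>n. (c k)\<^sup>2 * (norm (T (e k)))\<^sup>2)"
    unfolding x sum_distrib_left
    using decseqD[OF decseq_norm_T_e[OF e]]
    by (intro sum_mono) (simp add: mult.commute mult_left_mono power_mono)
  ultimately have "(norm (T (e n)) * norm ?x)\<^sup>2 \<le> (norm (T ?x))\<^sup>2"
    by (simp add: power_mult_distrib)
  then have "norm (T (e n)) * norm ?x \<le> norm (T ?x)"
    by (rule power2_le_imp_le) simp
  also have "\<dots> \<le> \<epsilon> * norm ?x" using c(2) by (intro assms) auto
  finally have "norm (T (e n)) * norm ?x \<le> \<epsilon> * norm ?x" .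
  moreover have "0 < (\<Sum>k\<le>n. (c k)\<^sup>2)" using c(1) by (auto intro!: sum_pos2)
  then have "(norm ?x)\<^sup>2 \<noteq> 0" using x by simp
  then have "norm ?x > 0" by simp
  ultimately show ?thesis by (simp add: singular_value_eq[OF e])
qed

end

section \<open>Monomials and the entries of the composed operator\<close>

lift_definition monomial :: "nat \<Rightarrow> L2" is "\<lambda>k t. t ^ k"
  by (simp add: L2_rel_def square_integrable_power)

lemma inner_monomial: "monomial j \<bullet> monomial k = 1 / (real j + real k + 1)"
  by transfer (simp add: power_add[symmetric] integral_unit_measure_power)

lemma norm_monomial_le: "norm (monomial k) \<le> 1"
  by (simp add: norm_eq_sqrt_inner inner_monomial divide_le_eq)

lemma Hausdorff_moment_entry: "Rep_ell2 (Hausdorff_moment z) j = z \<bullet> monomial j"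
  by transfer (simp add: mult.commute)

lemma ell2_eqI: "(\<And>j. Rep_ell2 a j = Rep_ell2 b j) \<Longrightarrow> a = b"
  by transfer auto

lemma summable_Rep_ell2: "summable (\<lambda>j. (Rep_ell2 a j)\<^sup>2)"
  using Rep_ell2 by auto

lemma norm_ell2_sq: "(norm a)\<^sup>2 = (\<Sum>j. (Rep_ell2 a j)\<^sup>2)"
  unfolding power2_norm_eq_inner by (simp add: inner_ell2.rep_eq power2_eq_square)

lemma ident_measurable_unit_measure: "(\<lambda>t::real. t) \<in> borel_measurable unit_measure"
  by (rule measurable_restrict_space1) (auto intro: measurable_completion)

lemma integral_unit_measure_tail_power:
  assumes "0 \<le> t" "t \<le> 1"
  shows "(LINT s|unit_measure. indicator {t<..} s * s ^ k) = (1 - t ^ Suc k) / (real k + 1)"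
proof -
  have "(LINT s|unit_measure. indicator {t<..} s * s ^ k)
      = (LINT s|lebesgue. indicator {0<..<1} s *\<^sub>R (indicator {t<..} s * s ^ k))"
    by (subst integral_restrict_space) auto
  also have "\<dots> = (LINT s|lborel. indicator {0<..<1} s *\<^sub>R (indicator {t<..} s * s ^ k))"
    by (rule integral_completion) measurable
  also have "\<dots> = (LINT s|lborel. s ^ k * indicator {t..1} s)"
  proof (rule integral_cong_AE)
    have "AE s in lborel. s \<noteq> t \<and> s \<noteq> (1::real)"
      using AE_lborel_singleton [of t] AE_lborel_singleton [of 1] by auto
    then show "AE s in lborel. indicator {0<..<1} s *\<^sub>R (indicator {t<..} s * s ^ k)
        = s ^ k * indicator {t..1::real} s"
      by eventually_elim (use assms in \<open>auto simp: indicator_def\<close>)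
  qed auto
  also have "\<dots> = (1 - t ^ Suc k) / (real k + 1)"
    using assms by (subst integral_power) (auto simp: add.commute)
  finally show ?thesis .
qed

text \<open>Exchanging the integrals over \<open>0 < t < s < 1\<close> leaves the inner integral of
  \<open>s ^ k\<close> from \<open>t\<close> to 1, which
  \<open>integral_unit_measure_tail_power\<close> evaluates.\<close>

lemma integration_inner_monomial:
  "integration x \<bullet> monomial k = (x \<bullet> monomial 0 - x \<bullet> monomial (Suc k)) / (real k + 1)"
proof transfer
  fix x :: "real \<Rightarrow> real" and k :: nat
  assume "L2_rel x x"
  then have sq: "square_integrable x" by (simp add: L2_rel_def)
  then have [measurable]: "x \<in> borel_measurable unit_measure" by (simp add: square_integrable_def)
  note [measurable] = ident_measurable_unit_measure
  have ix: "integrable unit_measure x" by (rule integrable_square_integrable[OF sq])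
  interpret P: pair_sigma_finite unit_measure unit_measure ..
  \<comment> \<open>The two indicators together encode \<open>0 < t < s\<close>, for all real
    \<open>t\<close>. On the unit interval \<open>f t s\<close> is dominated by \<open>x t\<close>,
    and \<open>x\<close> is integrable because the measure is finite; this justifies Fubini.\<close>
  define f where "f t s = indicator {t<..} s * (s ^ k * (indicator {0<..} t * x t))" for t s :: real
  have f_meas: "case_prod f \<in> borel_measurable (unit_measure \<Otimes>\<^sub>M unit_measure)"
    unfolding f_def indicator_def greaterThan_iff by measurable
  have f_le: "\<bar>f t s\<bar> \<le> \<bar>x t\<bar>" if "0 < s" "s < 1" for t s
  proof -
    have "\<bar>f t s\<bar> \<le> 1 * (1 * (1 * \<bar>x t\<bar>))"
      unfolding f_def abs_mult using that
      by (intro mult_mono) (auto simp: indicator_def power_abs power_le_one)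
    then show ?thesis by simp
  qed
  have f_int: "integrable unit_measure (f t)" for t
  proof (rule unit_measure.integrable_const_bound)
    show "AE s in unit_measure. norm (f t s) \<le> \<bar>x t\<bar>"
      by (rule AE_I2) (use f_le in auto)
    show "f t \<in> borel_measurable unit_measure"
      unfolding f_def indicator_def greaterThan_iff by measurable
  qed
  have m1: "measure unit_measure (space unit_measure) = 1"
    using integral_unit_measure_power[of 0] by simp
  have fint: "integrable (unit_measure \<Otimes>\<^sub>M unit_measure) (case_prod f)"
  proof (rule P.Fubini_integrable[OF f_meas])
    have "(\<lambda>t. LINT s|unit_measure. norm (case_prod f (t, s))) \<in> borel_measurable unit_measure"
      by (intro unit_measure.borel_measurable_lebesgue_integral) (use f_meas in measurable)
    moreover have "(LINT s|unit_measure. \<bar>f t s\<bar>) \<le> (LINT s|unit_measure. \<bar>x t\<bar>)" for t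
      by (rule integral_mono_AE) (use f_int f_le in \<open>auto intro!: AE_I2\<close>)
    then have "(LINT s|unit_measure. \<bar>f t s\<bar>) \<le> \<bar>x t\<bar>" for t
      using m1 by simp
    ultimately show "integrable unit_measure (\<lambda>t. LINT s|unit_measure. norm (case_prod f (t, s)))"
      by (intro Bochner_Integration.integrable_bound[OF ix]) auto
  qed (use f_int in simp)
  have "(LINT s|unit_measure. (LINT t:{0<..<s}|unit_measure. x t) * s ^ k)
      = (LINT s|unit_measure. LINT t|unit_measure. f t s)"
  proof (intro Bochner_Integration.integral_cong refl)
    fix s
    have "f t s = s ^ k * (indicator {0<..<s} t *\<^sub>R x t)" for t
      by (auto simp: f_def indicator_def)
    then show "(LINT t:{0<..<s}|unit_measure. x t) * s ^ k = (LINT t|unit_measure. f t s)"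
      by (simp add: set_lebesgue_integral_def)
  qed
  also have "\<dots> = (LINT t|unit_measure. LINT s|unit_measure. f t s)"
    by (rule P.Fubini_integral[OF fint])
  also have "\<dots> = (LINT t|unit_measure. (x t * t ^ 0 - x t * t ^ Suc k) / (real k + 1))"
  proof (intro Bochner_Integration.integral_cong refl)
    fix t assume "t \<in> space unit_measure"
    then have t: "0 < t" "t < 1" by auto
    have "(LINT s|unit_measure. f t s) = (LINT s|unit_measure. (indicator {t<..} s * s ^ k) * x t)"
      using t by (simp add: f_def mult.assoc)
    also have "\<dots> = (1 - t ^ Suc k) / (real k + 1) * x t"
      using t by (simp only: integral_mult_left_zero integral_unit_measure_tail_power less_imp_le)
    finally show "(LINT s|unit_measure. f t s) = (x t * t ^ 0 - x t * t ^ Suc k) / (real k + 1)"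
      by (simp add: algebra_simps)
  qed
  also have "\<dots> = ((LINT t|unit_measure. x t * t ^ 0) - (LINT t|unit_measure. x t * t ^ Suc k)) / (real k + 1)"
    using integrable_mult_square_integrable[OF sq square_integrable_power[of 0]]
      integrable_mult_square_integrable[OF sq square_integrable_power[of "Suc k"]]
    by (simp add: integral_diff)
  finally show "(LINT s|unit_measure. (LINT t:{0<..<s}|unit_measure. x t) * s ^ k)
      = ((LINT t|unit_measure. x t * t ^ 0) - (LINT t|unit_measure. x t * t ^ Suc k)) / (real k + 1)" .
qed

definition moment_integration :: "L2 \<Rightarrow> ell2" where
  "moment_integration = Hausdorff_moment \<circ> integration"

lemma moment_integration_entry:
  "Rep_ell2 (moment_integration x) j = (x \<bullet> monomial 0 - x \<bullet> monomial (Suc j)) / (real j + 1)"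
  by (simp add: moment_integration_def Hausdorff_moment_entry integration_inner_monomial)

lemma linear_moment_integration: "linear moment_integration"
proof
  fix x y and c :: real
  show "moment_integration (x + y) = moment_integration x + moment_integration y"
    by (rule ell2_eqI) (simp add: plus_ell2.rep_eq moment_integration_entry inner_add_left
        add_divide_distrib diff_divide_distrib)
  show "moment_integration (c *\<^sub>R x) = c *\<^sub>R moment_integration x"
    by (rule ell2_eqI) (simp add: scaleR_ell2.rep_eq moment_integration_entry algebra_simps diff_divide_distrib)
qed

text \<open>The bound is square-summable in \<open>j\<close> and uniform over the unit ball, which
  yields both boundedness and compactness.\<close>

lemma abs_moment_integration_entry_le:
  "\<bar>Rep_ell2 (moment_integration x) j\<bar> \<le> 2 * norm x / (real j + 1)"
proof -
  have "\<bar>x \<bullet> monomial k\<bar> \<le> norm x" for k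
    using Cauchy_Schwarz_ineq2[of x "monomial k"] norm_monomial_le[of k]
      mult_left_mono[of "norm (monomial k)" 1 "norm x"] by simp
  from this[of 0] this[of "Suc j"]
  have "\<bar>x \<bullet> monomial 0 - x \<bullet> monomial (Suc j)\<bar> \<le> 2 * norm x" by linarith
  then show ?thesis by (simp add: moment_integration_entry divide_right_mono)
qed

lemma summable_inverse_Suc_sq: "summable (\<lambda>j. (c / (real j + 1))\<^sup>2)"
  using summable_mult[OF summable_Suc_iff[THEN iffD2, OF inverse_power_summable[of 2, where 'a = real]], of "c\<^sup>2"]
  by (simp add: power_divide divide_inverse power_mult_distrib power_inverse add.commute)

lemma bounded_linear_moment_integration: "bounded_linear moment_integration"
proof -
  define C where "C = (\<Sum>j. (2 / (real j + 1))\<^sup>2)"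
  have "C \<ge> 0" unfolding C_def by (intro suminf_nonneg summable_inverse_Suc_sq) simp
  have "norm (moment_integration x) \<le> norm x * sqrt C" for x
  proof (rule power2_le_imp_le)
    have "(norm (moment_integration x))\<^sup>2 \<le> (\<Sum>j. (2 * norm x / (real j + 1))\<^sup>2)"
      unfolding norm_ell2_sq
    proof (intro suminf_le summable_Rep_ell2 summable_inverse_Suc_sq)
      fix j
      show "(Rep_ell2 (moment_integration x) j)\<^sup>2 \<le> (2 * norm x / (real j + 1))\<^sup>2"
        using power_mono[OF abs_moment_integration_entry_le abs_ge_zero, of x j 2] by simp
    qed
    also have "\<dots> = (\<Sum>j. (norm x)\<^sup>2 * (2 / (real j + 1))\<^sup>2)"
      by (simp add: power_divide power_mult_distrib mult.commute)
    also have "\<dots> = (norm x)\<^sup>2 * C"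
      unfolding C_def by (rule suminf_mult[OF summable_inverse_Suc_sq])
    finally show "(norm (moment_integration x))\<^sup>2 \<le> (norm x * sqrt C)\<^sup>2"
      using \<open>C \<ge> 0\<close> by (simp add: power_mult_distrib)
  qed (use \<open>C \<ge> 0\<close> in simp)
  then show ?thesis
    using linear_moment_integration by (intro bounded_linear_intro) (auto simp: linear_iff)
qed

section \<open>Compactness and the adjoint of the composed operator\<close>

text \<open>Compactness of the Hilbert cube. Tychonoff's theorem gives a coordinatewise convergent
  subsequence, and dominated convergence for series, with majorant \<open>4 * (M j)\<^sup>2\<close>,
  upgrades this to convergence in norm.\<close>

lemma ell2_dominated_convergent_subsequence:
  fixes a :: "nat \<Rightarrow> ell2" and M :: "nat \<Rightarrow> real"
  assumes le: "\<And>n j. \<bar>Rep_ell2 (a n) j\<bar> \<le> M j" and M: "summable (\<lambda>j. (M j)\<^sup>2)"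
  shows "\<exists>r l. strict_mono r \<and> (\<lambda>n. a (r n)) \<longlonglongrightarrow> l"
proof -
  have interval: "y \<in> {- c..c} \<longleftrightarrow> \<bar>y\<bar> \<le> c" for y c :: real by auto
  have "compactin (product_topology (\<lambda>_. euclidean) UNIV) (PiE UNIV (\<lambda>j. {- M j..M j}))"
    unfolding compactin_PiE by simp
  then have "compact (PiE UNIV (\<lambda>j. {- M j..M j}))"
    unfolding euclidean_product_topology compactin_euclidean_iff .
  then have "seq_compact (PiE UNIV (\<lambda>j. {- M j..M j}))" by (rule compact_imp_seq_compact)
  moreover have "\<forall>n. Rep_ell2 (a n) \<in> PiE UNIV (\<lambda>j. {- M j..M j})"
    using le by (simp add: PiE_iff interval del: atLeastAtMost_iff)
  ultimately obtain b r where b: "b \<in> PiE UNIV (\<lambda>j. {- M j..M j})" and r: "strict_mono r"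
    and lim: "((\<lambda>n. Rep_ell2 (a n)) \<circ> r) \<longlonglongrightarrow> b"
    by (rule seq_compactE)
  have coord: "(\<lambda>n. Rep_ell2 (a (r n)) j) \<longlonglongrightarrow> b j" for j
    using continuous_on_tendsto_compose[OF continuous_on_product_coordinates[of j] lim] by (simp add: o_def)
  have b_le: "\<bar>b j\<bar> \<le> M j" for j using b by (simp add: PiE_iff interval del: atLeastAtMost_iff)
  have "summable (\<lambda>j. (b j)\<^sup>2)"
  proof (rule summable_comparison_test'[OF M])
    fix j show "norm ((b j)\<^sup>2) \<le> (M j)\<^sup>2"
      using b_le[of j] power_mono[of "\<bar>b j\<bar>" "M j" 2] by simp
  qed
  then have Rep_b: "Rep_ell2 (Abs_ell2 b) = b" by (simp add: Abs_ell2_inverse)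
  have Rep_diff: "Rep_ell2 (x - y) j = Rep_ell2 x j - Rep_ell2 y j" for x y j
    unfolding minus_ell2_def plus_ell2.rep_eq uminus_ell2.rep_eq by simp
  have "((\<lambda>n. \<Sum>j. (Rep_ell2 (a (r n)) j - b j)\<^sup>2) \<longlonglongrightarrow> (\<Sum>j::nat. 0))"
  proof (rule tannerys_theorem[THEN conjunct2, THEN conjunct2])
    fix j
    have "(\<lambda>n. (Rep_ell2 (a (r n)) j - b j)\<^sup>2) \<longlonglongrightarrow> (b j - b j)\<^sup>2"
      by (intro tendsto_intros coord)
    then show "(\<lambda>n. (Rep_ell2 (a (r n)) j - b j)\<^sup>2) \<longlonglongrightarrow> 0" by simp
  next
    have "norm ((Rep_ell2 (a (r n)) j - b j)\<^sup>2) \<le> 4 * (M j)\<^sup>2" for j n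
    proof -
      have "\<bar>Rep_ell2 (a (r n)) j - b j\<bar> \<le> 2 * M j"
        using le[of "r n" j] b_le[of j] by linarith
      then show ?thesis
        using power_mono[of "\<bar>Rep_ell2 (a (r n)) j - b j\<bar>" "2 * M j" 2] by (simp add: power_mult_distrib)
    qed
    then show "\<forall>\<^sub>F (j, n) in sequentially \<times>\<^sub>F sequentially.
        norm ((Rep_ell2 (a (r n)) j - b j)\<^sup>2) \<le> 4 * (M j)\<^sup>2"
      by (intro always_eventually) auto
  qed (use M in \<open>auto intro: summable_mult\<close>)
  then have "(\<lambda>n. (norm (a (r n) - Abs_ell2 b))\<^sup>2) \<longlonglongrightarrow> 0"
    by (simp add: norm_ell2_sq Rep_diff Rep_b)
  then have "(\<lambda>n. a (r n)) \<longlonglongrightarrow> Abs_ell2 b"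
    using tendsto_real_sqrt[of "\<lambda>n. (norm (a (r n) - Abs_ell2 b))\<^sup>2" 0]
    by (simp add: tendsto_norm_zero_iff LIM_zero_iff)
  then show ?thesis using r by blast
qed

lemma compact_moment_integration:
  fixes x :: "nat \<Rightarrow> L2"
  assumes "\<And>n. norm (x n) \<le> 1"
  shows "\<exists>r l. strict_mono r \<and> (\<lambda>n. moment_integration (x (r n))) \<longlonglongrightarrow> l"
proof (rule ell2_dominated_convergent_subsequence[where a = "\<lambda>n. moment_integration (x n)" and M = "\<lambda>j. 2 / (real j + 1)"])
  fix n j :: nat
  show "\<bar>Rep_ell2 (moment_integration (x n)) j\<bar> \<le> 2 / (real j + 1)"
    by (rule order_trans[OF abs_moment_integration_entry_le]) (simp add: divide_right_mono assms)
qed (rule summable_inverse_Suc_sq)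

text \<open>The adjoint is written down explicitly: \<open>a\<close> is sent to the series of
  \<open>Rep_ell2 a j * (1 - t ^ Suc j) / (j + 1)\<close>. It converges absolutely and uniformly,
  since \<open>a\<close> and the reciprocals of \<open>j + 1\<close> are both
  square-summable.\<close>

lemma moment_integration_adjoint_exists:
  "\<exists>y. \<forall>x. moment_integration x \<bullet> a = x \<bullet> y"
proof -
  \<comment> \<open>extended by zero outside \<open>(0, 1)\<close>, where the series defining \<open>F\<close> below may diverge\<close>
  define h where "h j t = (if 0 < t \<and> t < 1 then (1 - t ^ Suc j) / (real j + 1) else 0)" for j and t :: real
  have h_meas[measurable]: "h j \<in> borel_measurable unit_measure" for j
    using ident_measurable_unit_measure unfolding h_def by measurable
  have h_le: "\<bar>h j t\<bar> \<le> 1 / (real j + 1)" for j t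
  proof -
    have "0 \<le> t ^ Suc j \<and> t ^ Suc j \<le> 1" if "0 < t" "t < 1"
      using that power_le_one[of t "Suc j"] by auto
    then show ?thesis by (auto simp: h_def intro!: divide_right_mono)
  qed
  define w where "w j = \<bar>Rep_ell2 a j\<bar> * (1 / (real j + 1))" for j
  have w: "summable w"
    using summable_mult_ell2[of "\<lambda>j. \<bar>Rep_ell2 a j\<bar>" "\<lambda>j. 1 / (real j + 1)"]
      summable_Rep_ell2[of a] summable_inverse_Suc_sq[of 1] by (simp add: w_def[abs_def] abs_mult)
  have ah_le: "\<bar>Rep_ell2 a j * h j t\<bar> \<le> w j" for j t
    using mult_left_mono[OF h_le[of j t], of "\<bar>Rep_ell2 a j\<bar>"] by (simp add: w_def[abs_def] abs_mult)
  have sum_ah: "summable (\<lambda>j. \<bar>Rep_ell2 a j * h j t\<bar>)" for t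
    by (rule summable_comparison_test'[OF w]) (use ah_le in auto)
  define F where "F t = (\<Sum>j. Rep_ell2 a j * h j t)" for t
  have F: "square_integrable F"
  proof (rule square_integrable_bounded)
    show "F \<in> borel_measurable unit_measure" unfolding F_def by measurable
    fix t
    have "\<bar>F t\<bar> \<le> (\<Sum>j. \<bar>Rep_ell2 a j * h j t\<bar>)" unfolding F_def by (rule summable_rabs[OF sum_ah])
    also have "\<dots> \<le> suminf w" by (intro suminf_le ah_le sum_ah w)
    finally show "\<bar>F t\<bar> \<le> suminf w" .
  qed
  have "moment_integration x \<bullet> a = x \<bullet> abs_L2 F" for x
  proof -
    define f where "f = rep_L2 x"
    have f: "square_integrable f" "x = abs_L2 f"
      using Quotient_rep_reflp[OF Quotient_L2, of x] Quotient_abs_rep[OF Quotient_L2, of x]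
      by (simp_all add: f_def L2_rel_def)
    have ip: "abs_L2 f \<bullet> abs_L2 g = (LINT t|unit_measure. f t * g t)" if "square_integrable g" for g
      using that f(1) by (simp add: inner_L2.abs_eq L2_rel_def)
    have if': "integrable unit_measure f" by (rule integrable_square_integrable[OF f(1)])
    have entry: "Rep_ell2 (moment_integration x) j = (LINT t|unit_measure. f t * h j t)" for j
    proof -
      have "(LINT t|unit_measure. f t * h j t)
          = (LINT t|unit_measure. (f t * t ^ 0 - f t * t ^ Suc j) / (real j + 1))"
        by (intro Bochner_Integration.integral_cong refl) (auto simp: h_def algebra_simps)
      also have "\<dots> = ((LINT t|unit_measure. f t * t ^ 0) - (LINT t|unit_measure. f t * t ^ Suc j)) / (real j + 1)"
        using integrable_mult_square_integrable[OF f(1) square_integrable_power[of 0]]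
          integrable_mult_square_integrable[OF f(1) square_integrable_power[of "Suc j"]]
        by (simp add: integral_diff)
      also have "\<dots> = Rep_ell2 (moment_integration x) j"
        unfolding moment_integration_entry f(2) monomial.abs_eq ip[OF square_integrable_power] ..
      finally show ?thesis by simp
    qed
    have hf: "integrable unit_measure (\<lambda>t. f t * h j t)" for j
      by (intro integrable_mult_square_integrable f(1) square_integrable_bounded[OF h_meas h_le])
    have term_le: "\<bar>f t * h j t * Rep_ell2 a j\<bar> \<le> \<bar>f t\<bar> * w j" for j t
      using mult_left_mono[OF ah_le[of j t], of "\<bar>f t\<bar>"] by (simp add: abs_mult mult_ac)
    have "moment_integration x \<bullet> a = (\<Sum>j. LINT t|unit_measure. f t * h j t * Rep_ell2 a j)"
      by (simp add: inner_ell2.rep_eq entry)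
    \<comment> \<open>Sum and integral commute because the terms are dominated by
      \<open>\<bar>f t\<bar> * w j\<close> with \<open>f\<close> integrable and \<open>w\<close>
      summable.\<close>
    also have "\<dots> = (LINT t|unit_measure. (\<Sum>j. f t * h j t * Rep_ell2 a j))"
    proof (rule integral_suminf[symmetric])
      show "integrable unit_measure (\<lambda>t. f t * h j t * Rep_ell2 a j)" for j
        using hf by simp
      show "AE t in unit_measure. summable (\<lambda>j. norm (f t * h j t * Rep_ell2 a j))"
        by (intro AE_I2 summable_comparison_test'[OF summable_mult[OF w]]) (use term_le in auto)
      have "(LINT t|unit_measure. norm (f t * h j t * Rep_ell2 a j)) \<le> (LINT t|unit_measure. \<bar>f t\<bar> * w j)" for j
        by (rule integral_mono) (use hf if' term_le in auto)
      then show "summable (\<lambda>j. LINT t|unit_measure. norm (f t * h j t * Rep_ell2 a j))"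
        by (intro summable_comparison_test'[OF summable_mult[OF w, of "LINT t|unit_measure. \<bar>f t\<bar>"]]) auto
    qed
    also have "\<dots> = (LINT t|unit_measure. f t * F t)"
      unfolding F_def using summable_rabs_cancel[OF sum_ah]
      by (intro Bochner_Integration.integral_cong refl) (simp add: suminf_mult[symmetric] mult_ac)
    also have "\<dots> = x \<bullet> abs_L2 F" using ip[OF F] f(2) by simp
    finally show ?thesis .
  qed
  then show ?thesis by blast
qed

section \<open>Lacunary monomials and the lower bound\<close>

text \<open>This is 1 / cosh ((i - k) ln 9), a function of the difference of the indices that decays
  geometrically. The base 81 is a square, so normalising a Gram matrix introduces no roots.\<close>

definition lacunary_kernel :: "nat \<Rightarrow> nat \<Rightarrow> real" where
  "lacunary_kernel i k = 2 * 9 ^ i * 9 ^ k / (81 ^ i + 81 ^ k)"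

lemma lacunary_kernel_sym: "lacunary_kernel i k = lacunary_kernel k i"
  by (simp add: lacunary_kernel_def mult_ac add.commute)

lemma lacunary_kernel_diag: "lacunary_kernel i i = 1"
  by (simp add: lacunary_kernel_def power_mult_distrib[symmetric])

lemma lacunary_kernel_le:
  assumes "i \<le> k"
  shows "lacunary_kernel i k \<le> 2 * 9 ^ i / 9 ^ k"
proof -
  have "lacunary_kernel i k \<le> 2 * 9 ^ i * 9 ^ k / 81 ^ k"
    unfolding lacunary_kernel_def by (intro divide_left_mono) (auto intro!: mult_pos_pos add_pos_pos)
  also have "\<dots> = 2 * 9 ^ i * 9 ^ k / (9 ^ k * 9 ^ k)"
    by (simp add: power_mult_distrib[symmetric])
  also have "\<dots> = 2 * 9 ^ i / 9 ^ k" by simp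
  finally show ?thesis .
qed

text \<open>On each side of the diagonal the entries are at most twice a power of 1/9, and 2 (1/9 +
  1/81 + ...) = 1/4. The function \<open>g\<close> consists of the partial sums of this majorant
  over both sides, up to a constant, and does not grow at \<open>k = i\<close>.\<close>

lemma lacunary_kernel_row_sum:
  "(\<Sum>k<N. if k = i then 0 else lacunary_kernel i k) \<le> 1 / 2"
proof -
  define g :: "nat \<Rightarrow> real"
    where "g k = (if k \<le> i then 9 ^ k / 9 ^ i / 4 else 1 / 2 - 9 ^ Suc i / 9 ^ k / 4)" for k
  have step: "(if k = i then 0 else lacunary_kernel i k) \<le> g (Suc k) - g k" for k
  proof (cases k i rule: linorder_cases)
    case less
    then have "g (Suc k) - g k = 2 * 9 ^ k / 9 ^ i" by (simp add: g_def field_simps)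
    then show ?thesis
      using less lacunary_kernel_le[of k i] by (simp add: lacunary_kernel_sym[of i k])
  next
    case equal
    then show ?thesis by (simp add: g_def)
  next
    case greater
    then have "g (Suc k) - g k = 2 * 9 ^ i / 9 ^ k" by (simp add: g_def field_simps)
    then show ?thesis using greater lacunary_kernel_le[of i k] by simp
  qed
  have g_0: "0 \<le> g 0" by (simp add: g_def)
  have "(\<Sum>k<N. if k = i then 0 else lacunary_kernel i k) \<le> (\<Sum>k<N. g (Suc k) - g k)"
    by (intro sum_mono step)
  also have "\<dots> = g N - g 0" by (rule sum_lessThan_telescope)
  also have "\<dots> \<le> 1 / 2"
  proof (cases "N \<le> i")
    case True
    then have le: "(9::real) ^ N / 9 ^ i \<le> 1" by (simp add: power_increasing)
    have g_N: "g N = 9 ^ N / 9 ^ i / 4" using True by (simp add: g_def)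
    have "g N \<le> 1 / 4" unfolding g_N by (rule divide_right_mono[OF le]) simp
    with g_0 show ?thesis by linarith
  next
    case False
    then have "g N \<le> 1 / 2" by (simp add: g_def)
    with g_0 show ?thesis by linarith
  qed
  finally show ?thesis .
qed

text \<open>Diagonal dominance: each off-diagonal product is at least minus the mean of the two
  squares times the entry. By symmetry both halves reduce to row sums, so at most 1/2 is lost from
  the unit diagonal.\<close>

lemma lacunary_form_ge:
  fixes u :: "nat \<Rightarrow> real"
  shows "(\<Sum>k<N. (u k)\<^sup>2) / 2 \<le> (\<Sum>i<N. \<Sum>k<N. u i * u k * lacunary_kernel i k)"
proof -
  define h where "h i k = (if k = i then 0 else lacunary_kernel i k)" for i k
  have h_nonneg: "0 \<le> h i k" for i k by (simp add: h_def lacunary_kernel_def)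
  have h_sym: "h i k = h k i" for i k by (simp add: h_def lacunary_kernel_sym[of i k])
  have pt: "u i * u k * lacunary_kernel i k
      \<ge> (if k = i then (u i)\<^sup>2 else 0) - ((u i)\<^sup>2 * h i k + (u k)\<^sup>2 * h k i) / 2" for i k
  proof (cases "k = i")
    case True
    then show ?thesis by (simp add: h_def lacunary_kernel_diag power2_eq_square)
  next
    case False
    have "0 \<le> (u i + u k)\<^sup>2 * h i k" using h_nonneg by simp
    then have "- ((u i)\<^sup>2 + (u k)\<^sup>2) / 2 * h i k \<le> u i * u k * h i k"
      by (simp add: power2_sum algebra_simps)
    then show ?thesis using False h_sym[of k i] by (simp add: h_def algebra_simps add_divide_distrib)
  qed
  have "(\<Sum>i<N. (u i)\<^sup>2 * (\<Sum>k<N. h i k)) \<le> (\<Sum>i<N. (u i)\<^sup>2 * (1 / 2))"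
    unfolding h_def by (intro sum_mono mult_left_mono lacunary_kernel_row_sum) auto
  then have row: "(\<Sum>i<N. \<Sum>k<N. (u i)\<^sup>2 * h i k) \<le> (\<Sum>k<N. (u k)\<^sup>2) / 2"
    by (simp add: sum_distrib_left sum_divide_distrib)
  have col: "(\<Sum>i<N. \<Sum>k<N. (u k)\<^sup>2 * h k i) = (\<Sum>i<N. \<Sum>k<N. (u i)\<^sup>2 * h i k)"
    by (rule sum.swap)
  have "(\<Sum>i<N. \<Sum>k<N. (if k = i then (u i)\<^sup>2 else 0) - ((u i)\<^sup>2 * h i k + (u k)\<^sup>2 * h k i) / 2)
      = (\<Sum>i<N. \<Sum>k<N. (if k = i then (u i)\<^sup>2 else 0))
        - ((\<Sum>i<N. \<Sum>k<N. (u i)\<^sup>2 * h i k) + (\<Sum>i<N. \<Sum>k<N. (u k)\<^sup>2 * h k i)) / 2"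
    by (simp only: sum_subtractf sum.distrib sum_divide_distrib[symmetric])
  also have "(\<Sum>i<N. \<Sum>k<N. (if k = i then (u i)\<^sup>2 else 0)) = (\<Sum>i<N. (u i)\<^sup>2)"
    by (intro sum.cong refl) simp
  finally have eq: "(\<Sum>i<N. \<Sum>k<N. (if k = i then (u i)\<^sup>2 else 0) - ((u i)\<^sup>2 * h i k + (u k)\<^sup>2 * h k i) / 2)
      = (\<Sum>i<N. (u i)\<^sup>2)
        - ((\<Sum>i<N. \<Sum>k<N. (u i)\<^sup>2 * h i k) + (\<Sum>i<N. \<Sum>k<N. (u k)\<^sup>2 * h k i)) / 2" .
  have "A / 2 \<le> A - (R + R) / 2" if "R \<le> A / 2" for A R :: real
    using that by simp
  from this[OF row] have "(\<Sum>k<N. (u k)\<^sup>2) / 2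
      \<le> (\<Sum>i<N. \<Sum>k<N. (if k = i then (u i)\<^sup>2 else 0) - ((u i)\<^sup>2 * h i k + (u k)\<^sup>2 * h k i) / 2)"
    unfolding eq col .
  also have "\<dots> \<le> (\<Sum>i<N. \<Sum>k<N. u i * u k * lacunary_kernel i k)"
    by (intro sum_mono pt)
  finally show ?thesis .
qed

text \<open>With these exponents the Gram matrix of the monomials, scaled to unit diagonal, is
  \<^const>\<open>lacunary_kernel\<close>, which is diagonally dominant.\<close>

definition lacunary_exponent :: "nat \<Rightarrow> nat" where
  "lacunary_exponent k = (81 ^ Suc k - 1) div 2"

lemma lacunary_exponent_eq: "2 * lacunary_exponent k + 1 = 81 ^ Suc k"
proof -
  have "odd ((81::nat) ^ Suc k)" by simp
  then show ?thesis by (simp add: lacunary_exponent_def del: power_Suc)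
qed

lemma real_lacunary_exponent: "2 * real (lacunary_exponent k) + 1 = 81 ^ Suc k"
  using arg_cong[OF lacunary_exponent_eq[of k], of real] by simp

lemma lacunary_exponent_pos: "0 < lacunary_exponent k"
  using lacunary_exponent_eq[of k] by (cases "lacunary_exponent k = 0") auto

lemma inj_lacunary_exponent: "inj lacunary_exponent"
proof (rule injI)
  fix i k assume "lacunary_exponent i = lacunary_exponent k"
  then have "(81::nat) ^ Suc i = 81 ^ Suc k" by (metis lacunary_exponent_eq)
  then show "i = k" by simp
qed

text \<open>Integrating \<open>c k * t ^ (p - 1)\<close> gives \<open>d k * t ^ p\<close> with
  \<open>d k = c k / p\<close>, and dividing by \<open>9 ^ Suc k\<close>, the inverse norm of
  \<open>t ^ p\<close>, gives \<open>u k\<close>; \<open>U\<close> is the sum of the squares of the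
  \<open>u k\<close>. Pairing the rows \<open>p\<close> of the image with \<open>d\<close> produces
  the lacunary form in \<open>u\<close>, and Cauchy-Schwarz turns its lower bound into one for the
  norm of the image.\<close>

lemma moment_integration_lacunary_bounds:
  fixes c :: "nat \<Rightarrow> real" and N :: nat
  defines "x \<equiv> (\<Sum>k<N. c k *\<^sub>R monomial (lacunary_exponent k - 1))"
  defines "U \<equiv> (\<Sum>k<N. (c k / lacunary_exponent k / 9 ^ Suc k)\<^sup>2)"
  shows "sqrt U \<le> 2 * 9 ^ N * norm (moment_integration x)"
    and "norm x \<le> 1458 ^ N * sqrt U"
proof -
  let ?p = lacunary_exponent
  define d where "d k = c k / ?p k" for k
  define u where "u k = d k / 9 ^ Suc k" for k
  define y where "y j = Rep_ell2 (moment_integration x) j" for j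
  have U: "U = (\<Sum>k<N. (u k)\<^sup>2)" by (simp add: U_def u_def d_def)
  have U_nonneg: "0 \<le> U" unfolding U by (simp add: sum_nonneg)
  have d_le: "(d k)\<^sup>2 \<le> (9 ^ N)\<^sup>2 * (u k)\<^sup>2" if "k < N" for k
  proof -
    have "((9::real) ^ Suc k)\<^sup>2 \<le> (9 ^ N)\<^sup>2"
      using that by (intro power_mono power_increasing) auto
    then have "(9 ^ Suc k)\<^sup>2 * (u k)\<^sup>2 \<le> (9 ^ N)\<^sup>2 * (u k)\<^sup>2" by (rule mult_right_mono) simp
    then show ?thesis by (simp add: u_def power_divide)
  qed
  have y: "y (?p i) = (\<Sum>k<N. d k * (2 / (81 ^ Suc i + 81 ^ Suc k)))" for i
  proof -
    have "c k * (monomial (?p k - 1) \<bullet> monomial 0 - monomial (?p k - 1) \<bullet> monomial (Suc (?p i)))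
        / (real (?p i) + 1) = d k * (2 / (81 ^ Suc i + 81 ^ Suc k))" for k
    proof -
      \<comment> \<open>Positivity of the exponent makes the truncated subtraction in
        \<open>?p k - 1\<close> exact. The factor \<open>Q + 1\<close> from the difference of
        reciprocals cancels the divisor of the row, leaving a Gram matrix entry.\<close>
      define P Q where "P = real (?p k)" and "Q = real (?p i)"
      have PQ: "P > 0" "Q > 0" using lacunary_exponent_pos by (auto simp: P_def Q_def)
      have "real (?p k - 1) = P - 1"
        using lacunary_exponent_pos[of k] by (simp add: P_def of_nat_diff)
      then have "real (?p k - 1) + real 0 + 1 = P" "real (?p k - 1) + real (Suc (?p i)) + 1 = P + Q + 1"
        by (simp_all only: Q_def of_nat_Suc)
      then have "c k * (monomial (?p k - 1) \<bullet> monomial 0 - monomial (?p k - 1) \<bullet> monomial (Suc (?p i)))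
          / (real (?p i) + 1) = c k * (1 / P - 1 / (P + Q + 1)) / (Q + 1)"
        by (simp only: inner_monomial Q_def)
      also have "1 / P - 1 / (P + Q + 1) = (Q + 1) / (P * (P + Q + 1))"
        using PQ by (simp add: field_simps)
      also have "c k * ((Q + 1) / (P * (P + Q + 1))) / (Q + 1) = d k * (1 / (P + Q + 1))"
        using PQ by (simp add: d_def P_def[symmetric])
      also have "1 / (P + Q + 1) = 2 / ((2 * Q + 1) + (2 * P + 1))"
        using PQ by (simp add: field_simps)
      finally show ?thesis unfolding P_def Q_def real_lacunary_exponent .
    qed
    then show ?thesis
      unfolding y_def moment_integration_entry x_def
      by (simp add: inner_sum_left sum_subtractf[symmetric] sum_divide_distrib right_diff_distrib[symmetric])
  qed
  have "(\<Sum>i<N. d i * y (?p i)) = (\<Sum>i<N. \<Sum>k<N. u i * u k * lacunary_kernel i k)"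
    unfolding y sum_distrib_left
  proof (intro sum.cong refl)
    fix i k
    have "d i * (d k * (2 / (81 ^ Suc i + 81 ^ Suc k)))
        = (u i * 9 ^ Suc i) * ((u k * 9 ^ Suc k) * (2 / (81 * (81 ^ i + 81 ^ k))))"
      by (simp add: u_def distrib_left)
    also have "\<dots> = u i * u k * lacunary_kernel i k"
    proof -
      have "(a * (9 * A)) * ((b * (9 * B)) * (2 / (81 * Z))) = a * b * (2 * A * B / Z)" for a b A B Z :: real
        by (simp add: field_simps)
      then show ?thesis unfolding power_Suc lacunary_kernel_def .
    qed
    finally show "d i * (d k * (2 / (81 ^ Suc i + 81 ^ Suc k))) = u i * u k * lacunary_kernel i k" .
  qed
  then have "U / 2 \<le> (\<Sum>i<N. d i * y (?p i))" using lacunary_form_ge[of u N] by (simp add: U)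
  also have "\<dots> \<le> (\<Sum>i<N. \<bar>d i\<bar> * \<bar>y (?p i)\<bar>)"
    by (intro sum_mono) (simp add: abs_mult[symmetric])
  also have "\<dots> \<le> L2_set d {..<N} * L2_set (\<lambda>i. y (?p i)) {..<N}"
    by (rule L2_set_mult_ineq)
  also have "\<dots> \<le> (9 ^ N * sqrt U) * norm (moment_integration x)"
  proof (intro mult_mono)
    have "(\<Sum>k<N. (d k)\<^sup>2) \<le> (9 ^ N)\<^sup>2 * U"
      unfolding U sum_distrib_left by (intro sum_mono d_le) auto
    then have "L2_set d {..<N} \<le> sqrt ((9 ^ N)\<^sup>2 * U)" unfolding L2_set_def by (rule real_sqrt_le_mono)
    then show "L2_set d {..<N} \<le> 9 ^ N * sqrt U" by (simp add: real_sqrt_mult)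
    \<comment> \<open>The exponents are distinct, so the selected rows contribute at most the full
      squared norm.\<close>
    have "(\<Sum>i<N. (y (?p i))\<^sup>2) = (\<Sum>j\<in>?p ` {..<N}. (y j)\<^sup>2)"
      by (subst sum.reindex) (auto intro: inj_on_subset[OF inj_lacunary_exponent])
    also have "\<dots> \<le> (norm (moment_integration x))\<^sup>2"
      unfolding norm_ell2_sq y_def by (intro sum_le_suminf summable_Rep_ell2) auto
    finally show "L2_set (\<lambda>i. y (?p i)) {..<N} \<le> norm (moment_integration x)"
      unfolding L2_set_def by (simp add: real_le_lsqrt)
  qed (simp_all add: U_nonneg L2_set_nonneg)
  finally have "sqrt U * sqrt U \<le> sqrt U * (2 * 9 ^ N * norm (moment_integration x))"
    using U_nonneg by (simp add: mult_ac)
  then show "sqrt U \<le> 2 * 9 ^ N * norm (moment_integration x)"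
  proof (cases "U = 0")
    case False
    then have "0 < sqrt U" using U_nonneg by simp
    with \<open>sqrt U * sqrt U \<le> _\<close> show ?thesis by (rule mult_left_le_imp_le)
  qed simp
  \<comment> \<open>A crude triangle inequality suffices for an exponential bound: 729 = 9 * 81
    collects the bounds for \<open>9 ^ Suc k\<close> and the exponent, and
    \<open>N \<le> 2 ^ N\<close> doubles the base to 1458.\<close>
  have "norm x \<le> (\<Sum>k<N. norm (c k *\<^sub>R monomial (?p k - 1)))"
    unfolding x_def by (rule norm_sum)
  also have "\<dots> \<le> (\<Sum>k<N. 729 ^ N * sqrt U)"
  proof (rule sum_mono)
    fix k assume k: "k \<in> {..<N}"
    have "norm (c k *\<^sub>R monomial (?p k - 1)) \<le> \<bar>c k\<bar>"
      using mult_left_mono[OF norm_monomial_le[of "?p k - 1"], of "\<bar>c k\<bar>"] by simp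
    also have "\<bar>c k\<bar> = \<bar>u k\<bar> * (9 ^ Suc k * real (?p k))"
      using lacunary_exponent_pos[of k] by (simp add: u_def d_def abs_mult abs_divide)
    also have "\<dots> \<le> sqrt U * (9 ^ N * 81 ^ N)"
    proof (intro mult_mono)
      have "(u k)\<^sup>2 \<le> U" unfolding U using k by (intro member_le_sum) auto
      then show "\<bar>u k\<bar> \<le> sqrt U" by (metis real_sqrt_abs real_sqrt_le_mono)
      show "(9::real) ^ Suc k \<le> 9 ^ N" using k by (intro power_increasing) auto
      have "real (?p k) \<le> 81 ^ Suc k" using real_lacunary_exponent[of k] by linarith
      also have "\<dots> \<le> 81 ^ N" using k by (intro power_increasing) auto
      finally show "real (?p k) \<le> 81 ^ N" .
    qed (simp_all add: U_nonneg)
    also have "\<dots> = 729 ^ N * sqrt U" by (simp add: power_mult_distrib[symmetric])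
    finally show "norm (c k *\<^sub>R monomial (?p k - 1)) \<le> 729 ^ N * sqrt U" .
  qed
  also have "\<dots> = real N * (729 ^ N * sqrt U)" by simp
  also have "\<dots> \<le> 2 ^ N * (729 ^ N * sqrt U)"
    using U_nonneg by (intro mult_right_mono) (auto simp: of_nat_less_two_power less_imp_le)
  also have "\<dots> = 1458 ^ N * sqrt U" by (simp add: power_mult_distrib[symmetric] mult.assoc[symmetric])
  finally show "norm x \<le> 1458 ^ N * sqrt U" .
qed

lemma moment_integration_lacunary_nonzero:
  assumes "\<exists>k<N. c k \<noteq> 0"
  shows "moment_integration (\<Sum>k<N. c k *\<^sub>R monomial (lacunary_exponent k - 1)) \<noteq> 0"
proof -
  obtain k where k: "k < N" "c k \<noteq> 0" using assms by blast
  have "0 < (\<Sum>k<N. (c k / lacunary_exponent k / 9 ^ Suc k)\<^sup>2)"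
    by (rule sum_pos2[of _ k]) (use k lacunary_exponent_pos[of k] in auto)
  then show ?thesis
    using moment_integration_lacunary_bounds(1)[where c = c and N = N] by auto
qed

lemma moment_integration_lacunary_ge:
  "1 / (2 * 13122 ^ N) * norm (\<Sum>k<N. c k *\<^sub>R monomial (lacunary_exponent k - 1))
    \<le> norm (moment_integration (\<Sum>k<N. c k *\<^sub>R monomial (lacunary_exponent k - 1)))"
  (is "_ * norm ?x \<le> _")
proof -
  have "norm ?x \<le> 1458 ^ N * sqrt (\<Sum>k<N. (c k / lacunary_exponent k / 9 ^ Suc k)\<^sup>2)"
    by (rule moment_integration_lacunary_bounds(2))
  \<comment> \<open>The two bounds combine to the base 13122 = 1458 * 9.\<close>
  also have "\<dots> \<le> 1458 ^ N * (2 * 9 ^ N * norm (moment_integration ?x))"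
    by (intro mult_left_mono moment_integration_lacunary_bounds(1)) auto
  also have "\<dots> = 2 * (1458 * 9) ^ N * norm (moment_integration ?x)"
    unfolding power_mult_distrib by simp
  finally show ?thesis by (simp add: divide_le_eq mult_ac)
qed

section \<open>Moments of functions orthogonal to low powers and the upper bound\<close>

text \<open>Duality: the polynomial \<open>w\<close> whose coefficients are the first
  \<open>N\<close> moments satisfies \<open>z \<bullet> w = S\<close>, while Hilbert's inequality
  bounds its squared norm by \<open>4 * S\<close>. Cauchy-Schwarz then bounds \<open>S\<close>
  uniformly in \<open>N\<close>.\<close>

lemma norm_Hausdorff_moment_le: "norm (Hausdorff_moment z) \<le> 2 * norm z"
proof (rule power2_le_imp_le)
  define b where "b j = z \<bullet> monomial j" for j
  have "(\<Sum>j<N. (b j)\<^sup>2) \<le> (2 * norm z)\<^sup>2" for N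
  proof -
    define S where "S = (\<Sum>j<N. (b j)\<^sup>2)"
    define w where "w = (\<Sum>j<N. b j *\<^sub>R monomial j)"
    have "w \<bullet> w = (\<Sum>j<N. \<Sum>k<N. b j * b k / (real j + real k + 1))"
      by (simp add: w_def inner_sum_left inner_sum_right inner_monomial sum_distrib_left mult_ac add_ac)
    then have w: "w \<bullet> w \<le> 4 * S" using Hilbert_inequality[of b N] by (simp add: S_def)
    have "z \<bullet> w = S" by (simp add: w_def S_def inner_sum_right b_def power2_eq_square)
    then have "S\<^sup>2 \<le> (z \<bullet> z) * (w \<bullet> w)" using Cauchy_Schwarz_ineq[of z w] by simp
    also have "\<dots> \<le> (z \<bullet> z) * (4 * S)" using w by (intro mult_left_mono) auto
    finally have "S * S \<le> S * (2 * norm z)\<^sup>2"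
      by (simp add: power2_eq_square[of S] power_mult_distrib power2_norm_eq_inner mult_ac)
    moreover have "0 \<le> S" unfolding S_def by (simp add: sum_nonneg)
    ultimately have "S \<le> (2 * norm z)\<^sup>2" by (cases "S = 0") simp_all
    then show ?thesis by (simp add: S_def)
  qed
  then show "(norm (Hausdorff_moment z))\<^sup>2 \<le> (2 * norm z)\<^sup>2"
    unfolding norm_ell2_sq
    by (intro suminf_le_const summable_Rep_ell2) (simp add: Hausdorff_moment_entry b_def)
qed simp

lemma moment_integration_le_of_orthogonal:
  assumes n: "0 < n" and orth: "\<And>k. k < n \<Longrightarrow> x \<bullet> monomial k = 0"
  shows "norm (moment_integration x) \<le> 2 / real n * norm x"
proof -
  let ?h = "Rep_ell2 (Hausdorff_moment x)"
  have tail: "summable (\<lambda>j. (?h (Suc j))\<^sup>2)"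
    using summable_Suc_iff[of "\<lambda>j. (?h j)\<^sup>2"] summable_Rep_ell2 by blast
  \<comment> \<open>As \<open>0 < n\<close>, the vector \<open>x\<close> is orthogonal to 1, so
    entry \<open>j\<close> is minus the moment of order \<open>Suc j\<close> divided by
    \<open>j + 1\<close>. Either this moment vanishes or the divisor is at least
    \<open>n\<close>.\<close>
  have "(Rep_ell2 (moment_integration x) j)\<^sup>2 \<le> (1 / real n)\<^sup>2 * (?h (Suc j))\<^sup>2" for j
  proof (cases "Suc j < n")
    case True
    then show ?thesis using n by (simp add: moment_integration_entry orth)
  next
    case False
    then have "\<bar>?h (Suc j)\<bar> / (real j + 1) \<le> \<bar>?h (Suc j)\<bar> / real n"
      using n by (intro divide_left_mono) auto
    then have "\<bar>Rep_ell2 (moment_integration x) j\<bar> \<le> \<bar>1 / real n * ?h (Suc j)\<bar>"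
      using n by (simp add: moment_integration_entry orth Hausdorff_moment_entry abs_divide)
    then show ?thesis
      unfolding power_mult_distrib[symmetric] abs_le_square_iff .
  qed
  then have "(norm (moment_integration x))\<^sup>2 \<le> (\<Sum>j. (1 / real n)\<^sup>2 * (?h (Suc j))\<^sup>2)"
    unfolding norm_ell2_sq
    by (intro suminf_le summable_Rep_ell2 summable_mult tail)
  also have "\<dots> = (1 / real n)\<^sup>2 * (\<Sum>j. (?h (Suc j))\<^sup>2)"
    by (rule suminf_mult[OF tail])
  also have "\<dots> \<le> (1 / real n)\<^sup>2 * (norm (Hausdorff_moment x))\<^sup>2"
    unfolding norm_ell2_sq suminf_split_head[OF summable_Rep_ell2[of "Hausdorff_moment x"]]
    by (intro mult_left_mono) auto
  finally have "(norm (moment_integration x))\<^sup>2 \<le> (1 / real n * norm (Hausdorff_moment x))\<^sup>2"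
    by (simp only: power_mult_distrib)
  then have "norm (moment_integration x) \<le> 1 / real n * norm (Hausdorff_moment x)"
    by (rule power2_le_imp_le) simp
  also have "\<dots> \<le> 1 / real n * (2 * norm x)" by (rule mult_left_mono[OF norm_Hausdorff_moment_le]) simp
  finally show ?thesis by simp
qed

section \<open>Both bounds combined\<close>

theorem corollary2:
  shows "\<exists>C1 C2 :: real. C1 > 0 \<and> C2 > 0 \<and>
    (\<forall>\<^sub>F i in sequentially.
       exp (- C1 * real i) \<le> singular_value (Hausdorff_moment \<circ> integration) i \<and>
       singular_value (Hausdorff_moment \<circ> integration) i \<le> C2 / real i)"
proof -
  obtain S where S: "\<And>x a. moment_integration x \<bullet> a = x \<bullet> S a"
    using moment_integration_adjoint_exists by metis
  interpret infinite_rank_compact_operator moment_integration S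
  proof (intro infinite_rank_compact_operator.intro compact_operator_adjoint.intro
      infinite_rank_compact_operator_axioms.intro)
    show "bounded_linear moment_integration" by (rule bounded_linear_moment_integration)
    show "moment_integration x \<bullet> a = x \<bullet> S a" for x a by (rule S)
    show "\<exists>r l. strict_mono r \<and> (\<lambda>n. moment_integration (x (r n))) \<longlonglongrightarrow> l"
      if "\<And>n. norm (x n) \<le> 1" for x :: "nat \<Rightarrow> L2"
      using that by (rule compact_moment_integration)
    show "\<exists>v :: nat \<Rightarrow> L2. \<forall>c. (\<exists>k\<le>n. c k \<noteq> 0) \<longrightarrow> moment_integration (\<Sum>k\<le>n. c k *\<^sub>R v k) \<noteq> 0" for n
      using moment_integration_lacunary_nonzero[of "Suc n"]
      by (intro exI[of _ "\<lambda>k. monomial (lacunary_exponent k - 1)"])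
        (simp add: lessThan_Suc_atMost less_Suc_eq_le)
  qed
  \<comment> \<open>26244 = 2 * 13122: enlarging the base absorbs the constant factor 2 of
    \<open>moment_integration_lacunary_ge\<close>.\<close>
  have lower: "exp (- ln 26244 * real (Suc n)) \<le> singular_value moment_integration (Suc n)" for n
  proof -
    have neg: "- ln 26244 * real (Suc n) = - (real (Suc n) * ln 26244)" by (simp only: mult_minus_left mult.commute)
    have "exp (real (Suc n) * ln 26244) = (26244::real) ^ Suc n" by (subst exp_of_nat_mult) simp
    also have "\<dots> = 2 ^ Suc n * 13122 ^ Suc n" by (subst power_mult_distrib[symmetric]) simp
    finally have "exp (- ln 26244 * real (Suc n)) = 1 / (2 ^ Suc n * 13122 ^ Suc n)"
      unfolding neg exp_minus by (simp only: inverse_eq_divide)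
    also have "\<dots> \<le> 1 / (2 * 13122 ^ Suc n)"
    proof (rule divide_left_mono)
      have "(2::real) ^ 1 \<le> 2 ^ Suc n" by (rule power_increasing) auto
      then show "(2::real) * 13122 ^ Suc n \<le> 2 ^ Suc n * 13122 ^ Suc n"
        by (intro mult_right_mono) auto
    qed auto
    also have "\<dots> \<le> singular_value moment_integration (Suc n)"
    proof (rule singular_value_ge[where v = "\<lambda>k. monomial (lacunary_exponent k - 1)"])
      show "moment_integration (\<Sum>k\<le>n. c k *\<^sub>R monomial (lacunary_exponent k - 1)) \<noteq> 0"
        if "\<exists>k\<le>n. c k \<noteq> 0" for c
        using that by (rule moment_integration_lacunary_nonzero
            [of "Suc n", unfolded lessThan_Suc_atMost less_Suc_eq_le])
    qed (rule moment_integration_lacunary_ge[of "Suc n", unfolded lessThan_Suc_atMost])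
    finally show ?thesis .
  qed
  \<comment> \<open>Orthogonality to \<open>n\<close> monomials controls singular value number
    \<open>n + 1\<close>; doubling the constant compensates for this shift when \<open>n\<close> is
    positive, whence the restriction to \<open>2 \<le> i\<close> below.\<close>
  have upper: "singular_value moment_integration (Suc n) \<le> 4 / real (Suc n)" if "0 < n" for n
  proof -
    have "singular_value moment_integration (Suc n) \<le> 2 / real n"
      using moment_integration_le_of_orthogonal[OF that]
      by (intro singular_value_le[where f = monomial]) auto
    also have "\<dots> \<le> 4 / real (Suc n)" using that by (simp add: divide_simps)
    finally show ?thesis .
  qed
  have "exp (- ln 26244 * real i) \<le> singular_value (Hausdorff_moment \<circ> integration) i \<and>
      singular_value (Hausdorff_moment \<circ> integration) i \<le> 4 / real i" if i: "2 \<le> i" for i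
  proof -
    obtain n where "i = Suc n" "0 < n" using i by (cases i) auto
    then show ?thesis unfolding moment_integration_def[symmetric] using lower upper by blast
  qed
  then have "\<forall>\<^sub>F i in sequentially.
      exp (- ln 26244 * real i) \<le> singular_value (Hausdorff_moment \<circ> integration) i \<and>
      singular_value (Hausdorff_moment \<circ> integration) i \<le> 4 / real i"
    by (rule eventually_sequentiallyI)
  then show ?thesis by (intro exI[of _ "ln 26244"] exI[of _ 4]) simp
qed

end
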